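(* Let $X$ be any (real or complex) separable infinite-dimensional Banach space. There exists a reiteratively recurrent cyclic operator $T:X\longrightarrow X$ whose set of reiteratively recurrent vectors $\mathrm{RRec}(T)$ is meager in $X$.
   Context: An operator on a Banach space $X$ over $\mathbb{K}\in\{\mathbb{R},\mathbb{C}\}$ is a continuous linear map $T:X\longrightarrow X$. For $x\in X$ and a neighbourhood $U$ of $x$, put $\mathcal{N}_T(x,U):=\{n\geq 1 \ ;\ T^nx\in U\}$. The upper Banach density of a set $J\subset\mathbb{N}$ of positive integers is $$\overline{\mathrm{Bd}}(J):=\limsup_{N\to\infty}\left(\max_{m\geq 0}\frac{\#\left(J\cap[m+1,m+N]\right)}{N}\right)$$ (the limit superior is in fact a limit). A vector $x\in X$ is reiteratively recurrent for $T$ if $\overline{\mathrm{Bd}}(\mathcal{N}_T(x,U))>0$ for every neighbourhood $U$ of $x$. $\mathrm{RRec}(T)$ denotes the set of reiteratively recurrent vectors for $T$, and $T$ is called reiteratively recurrent if $\mathrm{RRec}(T)$ is dense in $X$. A vector $x\in X$ is cyclic for $T$ if for every non-empty open set $U\subset X$ there is a polynomial $p$ with coefficients in $\mathbb{K}$ such that $p(T)x\in U$; $T$ is called cyclic if it admits a cyclic vector. *)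

theory Defs
  imports "HOL-Analysis.Analysis" "HOL-Computational_Algebra.Polynomial"
begin

text \<open>
  A complex Banach space is a type of class \<^class>\<open>banach\<close> (which carries the norm, its
  completeness and the underlying real structure) together with a complex scalar multiplication
  that extends the real one and for which the norm is homogeneous. Real Banach spaces are the
  types of class \<^class>\<open>banach\<close> themselves. Notions that depend on the scalar field take
  the scalar multiplication as an argument, so that they cover both cases.
\<close>

locale complex_banach_space = vector_space scl
  for scl :: "complex \<Rightarrow> 'a::banach \<Rightarrow> 'a" +
  assumes scale_of_real: "scl (complex_of_real r) x = r *\<^sub>R x"
    and norm_scale: "norm (scl c x) = cmod c * norm x"

definition infinite_dimensional :: "('k::field \<Rightarrow> 'a::ab_group_add \<Rightarrow> 'a) \<Rightarrow> bool" where
  "infinite_dimensional scl \<longleftrightarrow> (\<nexists>B. finite_dimensional_vector_space scl B)"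

definition is_operator ::
  "('k::field \<Rightarrow> 'a::real_normed_vector \<Rightarrow> 'a) \<Rightarrow> ('a \<Rightarrow> 'a) \<Rightarrow> bool" where
  "is_operator scl T \<longleftrightarrow> Vector_Spaces.linear scl scl T \<and> continuous_on UNIV T"

definition return_times :: "('a \<Rightarrow> 'a) \<Rightarrow> 'a \<Rightarrow> 'a set \<Rightarrow> nat set" where
  "return_times T x U = {n. n \<ge> 1 \<and> (T ^^ n) x \<in> U}"

text \<open>The maximum below is over an infinite index set, but only finitely many values occur.\<close>

lemma finite_window_densities:
  "finite (range (\<lambda>m. real (card (J \<inter> {m + 1..m + N})) / real N))"
proof -
  have "card (J \<inter> {m + 1..m + N}) \<le> N" for m
    using card_mono[of "{m + 1..m + N}" "J \<inter> {m + 1..m + N}"] by simp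
  then have "range (\<lambda>m. real (card (J \<inter> {m + 1..m + N})) / real N)
      \<subseteq> (\<lambda>k. real k / real N) ` {..N}"
    by auto
  then show ?thesis
    by (rule finite_subset) simp
qed

definition upper_Banach_density :: "nat set \<Rightarrow> ereal" where
  "upper_Banach_density J =
     limsup (\<lambda>N. ereal (Max (range (\<lambda>m. real (card (J \<inter> {m + 1..m + N})) / real N))))"

definition RRec :: "('a::topological_space \<Rightarrow> 'a) \<Rightarrow> 'a set" where
  "RRec T = {x. \<forall>U. x \<in> interior U \<longrightarrow> upper_Banach_density (return_times T x U) > 0}"

definition reiteratively_recurrent :: "('a::topological_space \<Rightarrow> 'a) \<Rightarrow> bool" where
  "reiteratively_recurrent T \<longleftrightarrow> closure (RRec T) = UNIV"

definition poly_apply ::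
  "('k::field \<Rightarrow> 'a::ab_group_add \<Rightarrow> 'a) \<Rightarrow> 'k poly \<Rightarrow> ('a \<Rightarrow> 'a) \<Rightarrow> 'a \<Rightarrow> 'a" where
  "poly_apply scl p T x = (\<Sum>i\<le>degree p. scl (coeff p i) ((T ^^ i) x))"

definition cyclic_vector ::
  "('k::field \<Rightarrow> 'a::real_normed_vector \<Rightarrow> 'a) \<Rightarrow> ('a \<Rightarrow> 'a) \<Rightarrow> 'a \<Rightarrow> bool" where
  "cyclic_vector scl T x \<longleftrightarrow>
     (\<forall>U. open U \<and> U \<noteq> {} \<longrightarrow> (\<exists>p. poly_apply scl p T x \<in> U))"

definition cyclic_operator ::
  "('k::field \<Rightarrow> 'a::real_normed_vector \<Rightarrow> 'a) \<Rightarrow> ('a \<Rightarrow> 'a) \<Rightarrow> bool" where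
  "cyclic_operator scl T \<longleftrightarrow> (\<exists>x. cyclic_vector scl T x)"

definition nowhere_dense :: "'a::topological_space set \<Rightarrow> bool" where
  "nowhere_dense S \<longleftrightarrow> interior (closure S) = {}"

definition meager :: "'a::topological_space set \<Rightarrow> bool" where
  "meager S \<longleftrightarrow> (\<exists>\<F>. countable \<F> \<and> (\<forall>F\<in>\<F>. nowhere_dense F) \<and> S = \<Union>\<F>)"

end

theory Submission
  imports Defs
begin

text \<open>
  The operator rotates infinitely many two-dimensional planes, by smaller and smaller rational
  fractions of a full turn, in a very distorted basis.

  A separable infinite-dimensional space carries a biorthogonal sequence with dense span
  (\<open>fundamental_biorthogonal_sequence\<close>). Its members are grouped into pairs (f k, g k) with coordinate
  functionals (fs k, gs k) and rescaled so that g k has norm 1 while fs k has norm at most (1/4)^k. The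
  operator T rotates the k-th plane by the angle pi / 2^(m k + 1). If m grows fast enough, then T differs
  from the identity by an absolutely convergent series, so it is bounded. Only real coefficients
  occur in the rotations, and so the real and the complex case are the same.

  Every vector in the span of the planes is periodic, and periodic vectors are reiteratively
  recurrent; hence T is reiteratively recurrent (\<open>reiteratively_recurrent_T\<close>).

  A generic vector x satisfies |gs k x| > (1/2)^k for infinitely many k, because a multiple of g k of
  norm 3 (1/2)^k is a small perturbation. For such k the coordinate of the orbit under fs k is a sinusoid
  a cos - b sin in time with |b| > (1/2)^k, whereas at a time when the orbit is back in the unit
  ball around x this coordinate is at most (1/4)^k (norm x + 1). Such a sinusoid is that
  small only for a proportion of times of order (1/2)^k, in every window of the length of a quarter
  period (\<open>return_gap_le\<close>, \<open>return_density_le\<close>). As k is arbitrarily large, the return times have upper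
  Banach density 0, and x is not reiteratively recurrent (\<open>meager_RRec_T\<close>).

  A rapidly convergent series of multiples of the f k is a cyclic vector. If h is half of the period of
  the plane L, then (I + T ^^ h) / 2 kills that plane and fixes the earlier ones; the limit of products
  of such operators cuts the series off at any given place, so each f k, and then each
  g k, lies in the closed cyclic subspace of the series (\<open>cyclic_operator_T\<close>).

  The coordinate functionals come from the Hahn-Banach theorem in its weakest form: bounded
  functionals separate points (\<open>bounded_functional_nonzero\<close>). A minimal sublinear function below the
  norm is linear, and minimal ones exist by Zorn's lemma.
\<close>

section \<open>Enough bounded functionals\<close>

definition sublinear :: "('a::real_vector \<Rightarrow> real) \<Rightarrow> bool" where
  "sublinear q \<longleftrightarrow> (\<forall>x y. q (x + y) \<le> q x + q y) \<and> (\<forall>c>0. \<forall>x. q (c *\<^sub>R x) \<le> c * q x)"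

lemma sublinear_add: "sublinear q \<Longrightarrow> q (x + y) \<le> q x + q y"
  by (simp add: sublinear_def)

lemma sublinear_scaleR:
  assumes "sublinear q" "c > 0"
  shows "q (c *\<^sub>R x) = c * q x"
proof (rule antisym)
  show "q (c *\<^sub>R x) \<le> c * q x"
    using assms by (simp add: sublinear_def)
  have "q ((1 / c) *\<^sub>R (c *\<^sub>R x)) \<le> (1 / c) * q (c *\<^sub>R x)"
    using assms unfolding sublinear_def by (meson zero_less_divide_1_iff)
  then show "c * q x \<le> q (c *\<^sub>R x)"
    using assms(2) by (simp add: field_simps)
qed

lemma sublinear_zero: "sublinear q \<Longrightarrow> q 0 = 0"
  using sublinear_scaleR[of q 2 0] by simp

lemma sublinear_minus: "sublinear q \<Longrightarrow> - q (- x) \<le> q x"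
  using sublinear_add[of q x "- x"] sublinear_zero[of q] by simp

text \<open>
  Averaging the growth of q in the direction y produces a sublinear minorant that is forced to be
  small at -y. This single construction serves twice: it shows that a minimal sublinear function is
  odd, and it pins the value of the functional at a chosen vector.
\<close>

lemma sublinear_tilt:
  fixes q :: "'a::real_vector \<Rightarrow> real"
  assumes q: "sublinear q"
  obtains r where "sublinear r" "r \<le> q" "r (- y) \<le> - q y"
proof -
  define g where "g x t = q (x + t *\<^sub>R y) - t * q y" for x t
  define r where "r x = (INF t\<in>{0..}. g x t)" for x
  have hom: "q (t *\<^sub>R y) = t * q y" if "t \<ge> 0" for t
    using that sublinear_scaleR[OF q] sublinear_zero[OF q] by (cases "t = 0") auto
  have lower: "- q (- x) \<le> g x t" if "t \<ge> 0" for x t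
    using sublinear_add[OF q, of "x + t *\<^sub>R y" "- x"] hom[OF that] by (simp add: g_def)
  have bdd: "bdd_below (g x ` {0..})" for x
    using lower by (intro bdd_belowI2[of _ "- q (- x)"]) auto
  have le: "r x \<le> g x t" if "t \<ge> 0" for x t
    unfolding r_def using that by (intro cINF_lower bdd) auto
  have "r (x + x') \<le> r x + r x'" for x x'
  proof -
    have "r (x + x') \<le> g x s + g x' t" if "s \<ge> 0" "t \<ge> 0" for s t
    proof -
      have "r (x + x') \<le> g (x + x') (s + t)" using that by (intro le) auto
      also have "\<dots> \<le> g x s + g x' t"
        using sublinear_add[OF q, of "x + s *\<^sub>R y" "x' + t *\<^sub>R y"]
        by (simp add: g_def algebra_simps)
      finally show ?thesis .
    qed
    then have "r (x + x') - g x s \<le> r x'" if "s \<ge> 0" for s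
      unfolding r_def[of x'] using that by (intro cINF_greatest) (auto simp: algebra_simps)
    then have "r (x + x') - r x' \<le> r x"
      unfolding r_def[of x] by (intro cINF_greatest) (auto simp: algebra_simps)
    then show ?thesis by simp
  qed
  moreover have "r (c *\<^sub>R x) \<le> c * r x" if "c > 0" for c x
  proof -
    have "r (c *\<^sub>R x) \<le> c * g x t" if "t \<ge> 0" for t
    proof -
      have "r (c *\<^sub>R x) \<le> g (c *\<^sub>R x) (c * t)"
        using that \<open>c > 0\<close> by (intro le) auto
      also have "\<dots> = q (c *\<^sub>R (x + t *\<^sub>R y)) - c * t * q y"
        by (simp add: g_def algebra_simps)
      also have "\<dots> = c * g x t"
        by (simp only: sublinear_scaleR[OF q \<open>c > 0\<close>]) (simp add: g_def algebra_simps)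
      finally show ?thesis .
    qed
    then have "r (c *\<^sub>R x) / c \<le> r x"
      unfolding r_def[of x] using \<open>c > 0\<close> by (intro cINF_greatest) (auto simp: field_simps)
    then show ?thesis using \<open>c > 0\<close> by (simp add: field_simps)
  qed
  ultimately have "sublinear r" by (simp add: sublinear_def)
  moreover have "r \<le> q"
    using le[of 0] by (auto simp: le_fun_def g_def)
  moreover have "r (- y) \<le> - q y"
    using le[of 1 "- y"] sublinear_zero[OF q] by (simp add: g_def)
  ultimately show thesis by (rule that)
qed

text \<open>
  Zorn's lemma for the reversed pointwise order. The pointwise infimum of a chain is finite because
  a sublinear minorant q of p satisfies -p(-x) \<le> -q(-x) \<le> q x, and it is subadditive because for two
  members of the chain the smaller one can be used at both points.
\<close>

lemma minimal_sublinear_exists: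
  fixes p :: "'a::real_vector \<Rightarrow> real"
  assumes p: "sublinear p"
  obtains m where "sublinear m" "m \<le> p" "\<And>q. sublinear q \<Longrightarrow> q \<le> m \<Longrightarrow> q = m"
proof -
  define A where "A = {q. sublinear q \<and> q \<le> p}"
  have "\<exists>m\<in>A. \<forall>a\<in>A. a \<le> m \<longrightarrow> a = m"
  proof (rule predicate_Zorn)
    show "partial_order_on A (relation_of (\<lambda>q r. r \<le> q) A)"
      by (rule partial_order_on_relation_ofI) auto
    fix C assume C: "C \<in> Chains (relation_of (\<lambda>q r. r \<le> q) A)"
    then have CA: "C \<subseteq> A" by (rule Chains_relation_of)
    have comp: "q \<le> r \<or> r \<le> q" if "q \<in> C" "r \<in> C" for q r
      using C that by (auto simp: Chains_def relation_of_def)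
    show "\<exists>u\<in>A. \<forall>a\<in>C. u \<le> a"
    proof (cases "C = {}")
      case True
      then show ?thesis using p by (auto simp: A_def)
    next
      case False
      define u where "u x = (INF q\<in>C. q x)" for x
      have "- p (- x) \<le> q x" if "q \<in> C" for q x
      proof -
        have "sublinear q" "q (- x) \<le> p (- x)" using that CA by (auto simp: A_def le_fun_def)
        then show ?thesis using sublinear_minus[of q x] by linarith
      qed
      then have bdd: "bdd_below ((\<lambda>q. q x) ` C)" for x
        by (intro bdd_belowI2[of _ "- p (- x)"])
      have le: "u x \<le> q x" if "q \<in> C" for q x
        unfolding u_def using that by (intro cINF_lower bdd)
      have "u (x + y) \<le> u x + u y" for x y
      proof -
        have "u (x + y) - q x \<le> r y" if "q \<in> C" "r \<in> C" for q r
        proof -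
          obtain s where s: "s \<in> C" "s \<le> q" "s \<le> r" using comp[of q r] \<open>q \<in> C\<close> \<open>r \<in> C\<close> by (metis order_refl)
          have "u (x + y) \<le> s (x + y)" by (rule le[OF s(1)])
          also have "\<dots> \<le> s x + s y" using s(1) CA by (auto simp: A_def sublinear_def)
          also have "\<dots> \<le> q x + r y" using s by (intro add_mono) (auto simp: le_fun_def)
          finally show ?thesis by simp
        qed
        then have le_u: "u (x + y) - q x \<le> u y" if "q \<in> C" for q
          unfolding u_def[of y] by (rule cINF_greatest[OF False]) (rule that)
        have "u (x + y) - u y \<le> q x" if "q \<in> C" for q
          using le_u[OF that] by linarith
        then have "u (x + y) - u y \<le> u x"
          unfolding u_def[of x] by (rule cINF_greatest[OF False])
        then show ?thesis by simp
      qed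
      moreover have "u (c *\<^sub>R x) \<le> c * u x" if "c > 0" for c x
      proof -
        have "u (c *\<^sub>R x) / c \<le> q x" if "q \<in> C" for q
          using le[OF that, of "c *\<^sub>R x"] sublinear_scaleR[of q c x] CA that \<open>c > 0\<close>
          by (auto simp: A_def field_simps)
        then have "u (c *\<^sub>R x) / c \<le> u x"
          unfolding u_def[of x] by (rule cINF_greatest[OF False])
        then show ?thesis using that by (simp add: field_simps)
      qed
      moreover have "u \<le> p"
      proof (rule le_funI)
        fix x
        obtain q where "q \<in> C" using False by blast
        then show "u x \<le> p x"
          using le[of q x] CA by (auto simp: A_def le_fun_def intro: order_trans)
      qed
      ultimately have "u \<in> A" by (simp add: A_def sublinear_def)
      moreover have "\<forall>a\<in>C. u \<le> a" by (intro ballI le_funI le)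
      ultimately show ?thesis by blast
    qed
  qed
  then obtain m where m: "m \<in> A" "\<forall>a\<in>A. a \<le> m \<longrightarrow> a = m" ..
  show thesis
  proof (rule that[of m])
    show "sublinear m" "m \<le> p" using m(1) by (auto simp: A_def)
    show "q = m" if "sublinear q" "q \<le> m" for q
      using m(2) that order_trans[OF that(2) \<open>m \<le> p\<close>] by (auto simp: A_def)
  qed
qed

text \<open>
  A minimal function coincides with each of its tilts, hence it is odd; an odd subadditive function is
  additive.
\<close>

lemma minimal_sublinear_linear:
  fixes m :: "'a::real_vector \<Rightarrow> real"
  assumes m: "sublinear m" and min: "\<And>q. sublinear q \<Longrightarrow> q \<le> m \<Longrightarrow> q = m"
  shows "linear m"
proof -
  have odd: "m (- y) = - m y" for y
  proof -
    obtain r where "sublinear r" "r \<le> m" "r (- y) \<le> - m y"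
      by (rule sublinear_tilt[OF m])
    then have "m (- y) \<le> - m y" using min by blast
    then show ?thesis using sublinear_minus[OF m, of y] by linarith
  qed
  have "m (x + y) = m x + m y" for x y
    using sublinear_add[OF m, of x y] sublinear_add[OF m, of "- x" "- y"] odd[of "x + y"]
    by (simp add: odd)
  moreover have "m (c *\<^sub>R x) = c *\<^sub>R m x" for c x
  proof -
    consider "c > 0" | "c = 0" | "- c > 0" by linarith
    then show ?thesis
    proof cases
      case 3
      then show ?thesis using sublinear_scaleR[OF m 3, of x] by (simp add: odd)
    qed (simp_all add: sublinear_scaleR[OF m] sublinear_zero[OF m])
  qed
  ultimately show ?thesis by (rule linearI)
qed

text \<open>
  The norm is first tilted at e, which forces every linear minorant to be at least norm e there.
  A minimal sublinear function below the tilted norm is such a linear minorant.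
\<close>

lemma bounded_functional_nonzero:
  fixes e :: "'a::real_normed_vector"
  assumes "e \<noteq> 0"
  obtains f :: "'a \<Rightarrow> real" where "bounded_linear f" "f e \<noteq> 0"
proof -
  have "sublinear (norm :: 'a \<Rightarrow> real)"
    by (simp add: sublinear_def norm_triangle_ineq)
  then obtain p :: "'a \<Rightarrow> real" where p: "sublinear p" "p \<le> norm" "p (- e) \<le> - norm e"
    by (rule sublinear_tilt)
  obtain f where f: "sublinear f" "f \<le> p" "\<And>q. sublinear q \<Longrightarrow> q \<le> f \<Longrightarrow> q = f"
    by (rule minimal_sublinear_exists[OF p(1)]) blast
  have lin: "linear f" using f(1,3) by (rule minimal_sublinear_linear)
  have le: "f x \<le> norm x" for x
    using f(2) p(2) by (meson le_fun_def order_trans)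
  have "\<bar>f x\<bar> \<le> norm x" for x
    using le[of x] le[of "- x"] linear_neg[OF lin, of x] by simp
  then have "bounded_linear f"
    using lin by (intro bounded_linear_intro[where K = 1]) (auto simp: linear_add linear_scale)
  moreover have "f (- e) \<le> - norm e"
    using f(2) p(3) by (meson le_fun_def order_trans)
  then have "f e \<noteq> 0"
    using assms linear_neg[OF lin, of e] by auto
  ultimately show thesis by (rule that)
qed

section \<open>Fundamental biorthogonal sequences\<close>

text \<open>
  Real and complex Banach spaces are treated simultaneously: the scalar field enters only through its
  norm and through the compatibility of its action with the real one.
\<close>

locale scalar_banach_space = vector_space scl
  for scl :: "'k::real_normed_field \<Rightarrow> 'a::banach \<Rightarrow> 'a" +
  assumes scale_of_real: "scl (of_real r) x = r *\<^sub>R x"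
    and norm_scale: "norm (scl c x) = norm c * norm x"
begin

definition functional :: "('a \<Rightarrow> 'k) \<Rightarrow> bool" where
  "functional \<phi> \<longleftrightarrow> bounded_linear \<phi> \<and> (\<forall>c x. \<phi> (scl c x) = c * \<phi> x)"

lemma bounded_linear_scale: "bounded_linear (scl c)"
proof (rule bounded_linear_intro[where K = "norm c"])
  show "scl c (r *\<^sub>R x) = r *\<^sub>R scl c x" for r x
    unfolding scale_of_real[symmetric] by (rule scale_left_commute)
qed (simp_all add: scale_right_distrib norm_scale mult.commute)

lemma bounded_linear_scale_left: "bounded_linear (\<lambda>c. scl c x)"
proof (rule bounded_linear_intro[where K = "norm x"])
  show "scl (r *\<^sub>R c) x = r *\<^sub>R scl c x" for r c
    unfolding scale_of_real[symmetric] scaleR_conv_of_real by simp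
qed (simp_all add: scale_left_distrib norm_scale)

lemma functional_compose_scale: "functional \<phi> \<Longrightarrow> bounded_linear (\<lambda>x. scl (\<phi> x) v)"
  using bounded_linear_compose[OF bounded_linear_scale_left, of \<phi> v] unfolding functional_def by blast

lemma functional_sum:
  assumes "\<And>i. i \<in> I \<Longrightarrow> functional (\<phi> i)"
  shows "functional (\<lambda>x. \<Sum>i\<in>I. c i * \<phi> i x)"
  using assms unfolding functional_def
  by (auto intro!: bounded_linear_sum bounded_linear_const_mult simp: sum_distrib_left mult_ac)

lemma functional_diff: "functional \<phi> \<Longrightarrow> functional \<psi> \<Longrightarrow> functional (\<lambda>x. \<phi> x - \<psi> x)"
  unfolding functional_def by (auto intro!: bounded_linear_sub simp: right_diff_distrib)

lemma functional_mult: "functional \<phi> \<Longrightarrow> functional (\<lambda>x. c * \<phi> x)"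
  unfolding functional_def by (auto intro!: bounded_linear_const_mult simp: mult_ac)

lemma functional_add: "functional \<phi> \<Longrightarrow> \<phi> (x + y) = \<phi> x + \<phi> y"
  using linear_add[OF bounded_linear.linear, of \<phi>] unfolding functional_def by blast

lemma functional_sub: "functional \<phi> \<Longrightarrow> \<phi> (x - y) = \<phi> x - \<phi> y"
  using linear_diff[OF bounded_linear.linear, of \<phi>] unfolding functional_def by blast

lemma functional_scale: "functional \<phi> \<Longrightarrow> \<phi> (scl c x) = c * \<phi> x"
  unfolding functional_def by blast

lemma functional_of_sum: "functional \<phi> \<Longrightarrow> \<phi> (\<Sum>i\<in>I. u i) = (\<Sum>i\<in>I. \<phi> (u i))"
  using linear_sum[OF bounded_linear.linear, of \<phi>] unfolding functional_def by blast

text \<open>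
  Finite stages of the construction are lists of pairs (vector, coordinate functional); for a
  biorthogonal list the partial expansion is the projection onto the span of the vectors along the common kernel
  of the functionals.
\<close>

definition partial_expansion :: "('a \<times> ('a \<Rightarrow> 'k)) list \<Rightarrow> 'a \<Rightarrow> 'a" where
  "partial_expansion L x = (\<Sum>i<length L. scl (snd (L ! i) x) (fst (L ! i)))"

definition biorthogonal_list :: "('a \<times> ('a \<Rightarrow> 'k)) list \<Rightarrow> bool" where
  "biorthogonal_list L \<longleftrightarrow>
     (\<forall>i<length L. functional (snd (L ! i))) \<and>
     (\<forall>i<length L. \<forall>j<length L. snd (L ! i) (fst (L ! j)) = (if i = j then 1 else 0))"

lemma functional_partial_expansion:
  assumes "biorthogonal_list L" "functional \<phi>"
  shows "\<phi> (partial_expansion L x) = (\<Sum>i<length L. \<phi> (fst (L ! i)) * snd (L ! i) x)"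
  unfolding partial_expansion_def functional_of_sum[OF assms(2)] functional_scale[OF assms(2)]
  by (simp add: mult.commute)

lemma coefficient_partial_expansion:
  assumes L: "biorthogonal_list L" and j: "j < length L"
  shows "snd (L ! j) (partial_expansion L x) = snd (L ! j) x"
proof -
  have "functional (snd (L ! j))" using assms by (simp add: biorthogonal_list_def)
  then have "snd (L ! j) (partial_expansion L x)
      = (\<Sum>i<length L. snd (L ! j) (fst (L ! i)) * snd (L ! i) x)"
    by (rule functional_partial_expansion[OF L])
  also have "\<dots> = (\<Sum>i<length L. if i = j then snd (L ! j) x else 0)"
    using L j by (intro sum.cong) (auto simp: biorthogonal_list_def)
  finally show ?thesis using j by simp
qed

text \<open>
  Gram-Schmidt with functionals. The new vector is the part of d missed by the projection, so that the
  old functionals vanish on it. Any functional that does not vanish on the new vector becomes the new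
  coordinate functional once it is composed with the complementary projection and normalised. No norm
  bound on it is claimed, so a functional separating one vector from 0 suffices.
\<close>

lemma biorthogonal_list_extend:
  assumes L: "biorthogonal_list L"
    and d: "partial_expansion L d \<noteq> d"
    and sep: "\<And>e. e \<noteq> 0 \<Longrightarrow> \<exists>\<phi>. functional \<phi> \<and> \<phi> e \<noteq> 0"
  obtains z where "biorthogonal_list (L @ [z])" "partial_expansion (L @ [z]) d = d"
    "\<And>x. partial_expansion L x = x \<Longrightarrow> partial_expansion (L @ [z]) x = x"
proof -
  define e where "e = d - partial_expansion L d"
  obtain \<psi> where \<psi>: "functional \<psi>" "\<psi> e \<noteq> 0"
  proof -
    have "e \<noteq> 0" unfolding e_def using d by simp
    from sep[OF this] show thesis by (elim exE conjE that)
  qed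
  \<comment> \<open>the functional psi composed with the complementary projection\<close>
  define \<eta> where "\<eta> x = \<psi> x - (\<Sum>i<length L. \<psi> (fst (L ! i)) * snd (L ! i) x)" for x
  have \<eta>: "functional \<eta>"
    unfolding \<eta>_def
  proof (rule functional_diff[OF \<psi>(1)], rule functional_sum)
    show "functional (snd (L ! i))" if "i \<in> {..<length L}" for i
      using L that by (simp add: biorthogonal_list_def)
  qed
  have \<eta>_alt: "\<eta> x = \<psi> x - \<psi> (partial_expansion L x)" for x
    by (simp add: \<eta>_def functional_partial_expansion[OF L \<psi>(1)])
  have coeff_e: "snd (L ! j) e = 0" if "j < length L" for j
  proof -
    have "functional (snd (L ! j))" using L that by (simp add: biorthogonal_list_def)
    from functional_sub[OF this] show ?thesis
      unfolding e_def using coefficient_partial_expansion[OF L that, of d] by simp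
  qed
  then have "partial_expansion L e = 0"
    by (simp add: partial_expansion_def)
  moreover have "\<psi> 0 = 0"
    using functional_sub[OF \<psi>(1), of 0 0] by simp
  ultimately have \<eta>e: "\<eta> e \<noteq> 0"
    using \<psi>(2) by (simp add: \<eta>_alt)
  define \<phi> where "\<phi> x = (1 / \<eta> e) * \<eta> x" for x
  have \<phi>: "functional \<phi>" unfolding \<phi>_def by (rule functional_mult[OF \<eta>])
  have \<phi>e: "\<phi> e = 1" using \<eta>e by (simp add: \<phi>_def)
  have \<phi>0: "\<phi> x = 0" if "partial_expansion L x = x" for x
    by (simp add: \<phi>_def \<eta>_alt that)
  have member: "partial_expansion L (fst (L ! j)) = fst (L ! j)" if "j < length L" for j
  proof -
    have "partial_expansion L (fst (L ! j)) = (\<Sum>i<length L. if i = j then fst (L ! j) else 0)"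
      unfolding partial_expansion_def using L that
      by (intro sum.cong) (auto simp: biorthogonal_list_def)
    then show ?thesis using that by simp
  qed
  have idem: "partial_expansion L (partial_expansion L x) = partial_expansion L x" for x
  proof -
    have "partial_expansion L (partial_expansion L x) = (\<Sum>i<length L. scl (snd (L ! i) x) (fst (L ! i)))"
      unfolding partial_expansion_def[of L "partial_expansion L x"]
      by (intro sum.cong) (simp_all add: coefficient_partial_expansion[OF L])
    then show ?thesis by (simp add: partial_expansion_def)
  qed
  have step: "partial_expansion (L @ [(e, \<phi>)]) x = partial_expansion L x + scl (\<phi> x) e" for x
    by (simp add: partial_expansion_def nth_append)
  show thesis
  proof (rule that)
    show "biorthogonal_list (L @ [(e, \<phi>)])"
      unfolding biorthogonal_list_def
    proof (intro conjI allI impI)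
      fix i assume "i < length (L @ [(e, \<phi>)])"
      then show "functional (snd ((L @ [(e, \<phi>)]) ! i))"
        using L \<phi> by (cases "i < length L") (auto simp: nth_append biorthogonal_list_def)
    next
      fix i j assume "i < length (L @ [(e, \<phi>)])" "j < length (L @ [(e, \<phi>)])"
      then consider "i < length L" "j < length L" | "i < length L" "j = length L"
        | "i = length L" "j < length L" | "i = length L" "j = length L" by fastforce
      then show "snd ((L @ [(e, \<phi>)]) ! i) (fst ((L @ [(e, \<phi>)]) ! j)) = (if i = j then 1 else 0)"
      proof cases
        case 1
        then show ?thesis using L by (simp add: nth_append biorthogonal_list_def)
      next
        case 2
        then show ?thesis using coeff_e by (simp add: nth_append)
      next
        case 3
        then show ?thesis using \<phi>0[OF member] by (simp add: nth_append)
      next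
        case 4
        then show ?thesis using \<phi>e by simp
      qed
    qed
    show "partial_expansion (L @ [(e, \<phi>)]) x = x" if "partial_expansion L x = x" for x
      using that \<phi>0[OF that] by (simp add: step)
    have "\<phi> d = \<phi> e + \<phi> (partial_expansion L d)"
      unfolding e_def functional_sub[OF \<phi>] by simp
    then have "\<phi> d = 1"
      using \<phi>0[OF idem] \<phi>e by simp
    then show "partial_expansion (L @ [(e, \<phi>)]) d = d"
      unfolding step by (simp add: e_def)
  qed
qed

lemma partial_expansion_in_span: "partial_expansion L x \<in> span (fst ` set L)"
  unfolding partial_expansion_def by (intro span_sum span_scale span_base) auto

lemma closed_partial_expansion_fixed:
  assumes "biorthogonal_list L"
  shows "closed {x. partial_expansion L x = x}"
proof -
  have "bounded_linear (\<lambda>x. scl (snd (L ! i) x) (fst (L ! i)))" if "i < length L" for i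
    using assms that by (intro functional_compose_scale) (simp add: biorthogonal_list_def)
  then have "continuous_on UNIV (partial_expansion L)"
    unfolding partial_expansion_def by (intro linear_continuous_on bounded_linear_sum) simp
  then show ?thesis by (intro closed_Collect_eq continuous_on_id)
qed

lemma not_infinite_dimensional_if_finite_span:
  assumes "finite S" "span S = UNIV"
  shows "\<not> infinite_dimensional scl"
proof -
  obtain B where B: "B \<subseteq> S" "independent B" "S \<subseteq> span B"
    using maximal_independent_subset[of S] by blast
  have "span B = UNIV"
    using span_mono[OF B(3)] assms(2) by (auto simp: span_span)
  then have "finite_dimensional_vector_space scl B"
    using B(1,2) assms(1) by unfold_locales (auto intro: finite_subset)
  then show ?thesis by (auto simp: infinite_dimensional_def)
qed

text \<open>
  A dense sequence is fed into the extension step, always at the first term that is not yet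
  reproduced by the projection. Such a term exists at every stage because the fixed points of the
  projection form a closed finite-dimensional subspace, and the choice of the first one guarantees that
  after n steps the first n terms are all reproduced.
\<close>

lemma fundamental_biorthogonal_sequence:
  assumes sep: "\<And>e. e \<noteq> 0 \<Longrightarrow> \<exists>\<phi>. functional \<phi> \<and> \<phi> e \<noteq> 0"
    and separable: "separable_space (euclidean :: 'a topology)"
    and infdim: "infinite_dimensional scl"
  obtains e :: "nat \<Rightarrow> 'a" and \<phi> :: "nat \<Rightarrow> 'a \<Rightarrow> 'k"
  where "\<And>n. functional (\<phi> n)" "\<And>i j. \<phi> i (e j) = (if i = j then 1 else 0)"
    "closure (span (range e)) = UNIV"
proof -
  obtain C :: "'a set" where C: "countable C" "closure C = UNIV"
    using separable by (auto simp: separable_space_def)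
  then have "C \<noteq> {}" by auto
  define d where "d = from_nat_into C"
  have d: "range d = C"
    unfolding d_def using \<open>C \<noteq> {}\<close> C(1) by (rule range_from_nat_into)
  define good where
    "good n L \<longleftrightarrow> length L = n \<and> biorthogonal_list L \<and> (\<forall>m<n. partial_expansion L (d m) = d m)" for n L
  have "\<exists>L. \<forall>n. good n (L n) \<and> (\<exists>z. L (Suc n) = L n @ [z])"
  proof (rule dependent_nat_choice)
    show "\<exists>L. good 0 L" by (simp add: good_def biorthogonal_list_def)
    fix L n assume L: "good n L"
    have "\<exists>m. partial_expansion L (d m) \<noteq> d m"
    proof (rule ccontr)
      assume "\<nexists>m. partial_expansion L (d m) \<noteq> d m"
      then have "C \<subseteq> {x. partial_expansion L x = x}" using d by auto
      then have "closure C \<subseteq> {x. partial_expansion L x = x}"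
        using L by (intro closure_minimal closed_partial_expansion_fixed) (auto simp: good_def)
      then have "partial_expansion L x = x" for x using C(2) by auto
      then have "span (fst ` set L) = UNIV" using partial_expansion_in_span[of L] by force
      then show False using not_infinite_dimensional_if_finite_span[of "fst ` set L"] infdim by simp
    qed
    then obtain m where m: "partial_expansion L (d m) \<noteq> d m"
      and least: "\<And>i. i < m \<Longrightarrow> partial_expansion L (d i) = d i"
      using exists_least_iff[of "\<lambda>m. partial_expansion L (d m) \<noteq> d m"] by blast
    have "n \<le> m" using m L by (meson good_def not_le)
    obtain z where z: "biorthogonal_list (L @ [z])" "partial_expansion (L @ [z]) (d m) = d m"
      "\<And>x. partial_expansion L x = x \<Longrightarrow> partial_expansion (L @ [z]) x = x"
      using biorthogonal_list_extend[OF _ m sep] L by (auto simp: good_def)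
    have "partial_expansion (L @ [z]) (d i) = d i" if "i < Suc n" for i
      using that \<open>n \<le> m\<close> z(2) z(3)[OF least] by (cases "i = m") auto
    then have "good (Suc n) (L @ [z])" using L z(1) by (auto simp: good_def)
    then show "\<exists>L'. good (Suc n) L' \<and> (\<exists>z. L' = L @ [z])" by blast
  qed
  then obtain L where good: "\<And>n. good n (L n)" and step: "\<And>n. \<exists>z. L (Suc n) = L n @ [z]"
    by blast
  \<comment> \<open>the lists extend one another, so their entries define infinite sequences\<close>
  have stable: "L m ! i = L n ! i" if "i < n" "n \<le> m" for i n m
    using that(2)
  proof (induction m rule: dec_induct)
    case (step m)
    obtain z where "L (Suc m) = L m @ [z]" using \<open>\<And>n. \<exists>z. L (Suc n) = L n @ [z]\<close> by blast
    moreover have "i < length (L m)" using good[of m] step.hyps that(1) by (simp add: good_def)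
    ultimately show ?case using step.IH by (simp add: nth_append)
  qed simp
  define e where "e n = fst (L (Suc n) ! n)" for n
  define \<phi> where "\<phi> n = snd (L (Suc n) ! n)" for n
  have e: "fst (L m ! n) = e n" and \<phi>: "snd (L m ! n) = \<phi> n" if "n < m" for n m
    using stable[of n "Suc n" m] that by (simp_all add: e_def \<phi>_def)
  have "C \<subseteq> span (range e)"
  proof
    fix x assume "x \<in> C"
    then obtain m where "x = d m" using d by blast
    then have "x = partial_expansion (L (Suc m)) x"
      using good[of "Suc m"] unfolding good_def by (metis lessI)
    also have "\<dots> \<in> span (fst ` set (L (Suc m)))" by (rule partial_expansion_in_span)
    also have "\<dots> \<subseteq> span (range e)"
    proof (intro span_mono subsetI)
      fix v assume "v \<in> fst ` set (L (Suc m))"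
      then obtain i where "i < length (L (Suc m))" "v = fst (L (Suc m) ! i)"
        by (auto simp: in_set_conv_nth)
      then show "v \<in> range e" using good[of "Suc m"] e[of i "Suc m"] by (simp add: good_def)
    qed
    finally show "x \<in> span (range e)" .
  qed
  then have dense: "closure (span (range e)) = UNIV"
    using closure_mono[of C "span (range e)"] C(2) by auto
  show thesis
  proof (rule that[OF _ _ dense])
    show "functional (\<phi> n)" for n
      using good[of "Suc n"] unfolding good_def biorthogonal_list_def \<phi>_def by (metis lessI)
    show "\<phi> i (e j) = (if i = j then 1 else 0)" for i j
    proof -
      define m where "m = Suc (max i j)"
      have "i < m" "j < m" by (auto simp: m_def)
      then have "snd (L m ! i) (fst (L m ! j)) = (if i = j then 1 else 0)"
        using good[of m] by (simp add: good_def biorthogonal_list_def)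
      then show ?thesis using e[OF \<open>j < m\<close>] \<phi>[OF \<open>i < m\<close>] by simp
    qed
  qed
qed

end

section \<open>Upper Banach density of sparse and of periodic sets\<close>

text \<open>
  If two elements of J at distance less than q are in fact at distance at most \<eta> q, then all elements
  of J in a window of length q lie in an interval of length \<eta> q behind the first one.
\<close>

lemma card_window_le:
  fixes J :: "nat set"
  assumes "\<eta> \<ge> 0"
    and gap: "\<And>i j. i \<in> J \<Longrightarrow> j \<in> J \<Longrightarrow> i < j \<Longrightarrow> j < i + q \<Longrightarrow> real (j - i) \<le> \<eta> * real q"
  shows "real (card (J \<inter> {m + 1..m + q})) \<le> \<eta> * real q + 1"
proof (cases "J \<inter> {m + 1..m + q} = {}")
  case True
  then show ?thesis using assms(1) by (simp del: atLeastAtMost_iff)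
next
  case False
  define W where "W = J \<inter> {m + 1..m + q}"
  define i where "i = Min W"
  have fin: "finite W" by (simp add: W_def)
  have i: "i \<in> W" unfolding i_def using fin False by (intro Min_in) (auto simp: W_def)
  have "W \<subseteq> {i..i + nat \<lfloor>\<eta> * real q\<rfloor>}"
  proof
    fix j assume j: "j \<in> W"
    then have "i \<le> j" unfolding i_def using fin by simp
    moreover have "real (j - i) \<le> \<eta> * real q"
      using gap[of i j] i j \<open>i \<le> j\<close> \<open>\<eta> \<ge> 0\<close> by (cases "i = j") (auto simp: W_def)
    then have "j - i \<le> nat \<lfloor>\<eta> * real q\<rfloor>" by (simp add: le_nat_floor)
    ultimately show "j \<in> {i..i + nat \<lfloor>\<eta> * real q\<rfloor>}" by auto
  qed
  then have "card W \<le> card {i..i + nat \<lfloor>\<eta> * real q\<rfloor>}" by (intro card_mono) auto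
  also have "\<dots> = nat \<lfloor>\<eta> * real q\<rfloor> + 1" by simp
  finally have "real (card W) \<le> real (nat \<lfloor>\<eta> * real q\<rfloor>) + 1" by linarith
  also have "real (nat \<lfloor>\<eta> * real q\<rfloor>) \<le> \<eta> * real q" using \<open>\<eta> \<ge> 0\<close> by simp
  finally show ?thesis by (simp add: W_def)
qed

lemma card_long_window_le:
  fixes J :: "nat set"
  assumes "\<And>m. real (card (J \<inter> {m + 1..m + q})) \<le> B"
  shows "real (card (J \<inter> {m + 1..m + n * q})) \<le> real n * B"
proof (induction n)
  case (Suc n)
  have "J \<inter> {m + 1..m + Suc n * q}
      \<subseteq> J \<inter> {m + 1..m + n * q} \<union> J \<inter> {m + n * q + 1..m + n * q + q}"
    by auto
  then have "card (J \<inter> {m + 1..m + Suc n * q})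
      \<le> card (J \<inter> {m + 1..m + n * q} \<union> J \<inter> {m + n * q + 1..m + n * q + q})"
    by (intro card_mono) auto
  also have "\<dots> \<le> card (J \<inter> {m + 1..m + n * q}) + card (J \<inter> {m + n * q + 1..m + n * q + q})"
    by (rule card_Un_le)
  finally have "real (card (J \<inter> {m + 1..m + Suc n * q})) \<le> real (card (J \<inter> {m + 1..m + n * q}))
      + real (card (J \<inter> {m + n * q + 1..m + n * q + q}))" by linarith
  also have "\<dots> \<le> real n * B + B"
    using Suc.IH assms[of "m + n * q"] by linarith
  finally show ?case by (simp add: algebra_simps)
qed simp

text \<open>
  A window of length N \<ge> q is covered by N div q + 1 \<le> 2 N / q windows of length q; this crude count
  accounts for the factor 2.
\<close>

lemma upper_Banach_density_le:
  fixes J :: "nat set"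
  assumes "q > 0" "\<eta> \<ge> 0"
    and gap: "\<And>i j. i \<in> J \<Longrightarrow> j \<in> J \<Longrightarrow> i < j \<Longrightarrow> j < i + q \<Longrightarrow> real (j - i) \<le> \<eta> * real q"
  shows "upper_Banach_density J \<le> ereal (2 * (\<eta> + 1 / real q))"
  unfolding upper_Banach_density_def
proof (rule Limsup_bounded, unfold eventually_sequentially, intro exI allI impI)
  fix N assume N: "q \<le> N"
  have window: "real (card (J \<inter> {m + 1..m + q})) \<le> \<eta> * real q + 1" for m
    by (rule card_window_le[OF \<open>\<eta> \<ge> 0\<close> gap])
  have "real (card (J \<inter> {m + 1..m + N})) / real N \<le> 2 * (\<eta> + 1 / real q)" for m
  proof -
    have "N \<le> (N div q + 1) * q"
      using \<open>q > 0\<close> by (metis Suc_eq_plus1 dividend_less_div_times less_imp_le mult.commute mult_Suc_right add.commute mult_Suc)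
    then have "card (J \<inter> {m + 1..m + N}) \<le> card (J \<inter> {m + 1..m + (N div q + 1) * q})"
      by (intro card_mono) auto
    then have "real (card (J \<inter> {m + 1..m + N})) \<le> real (N div q + 1) * (\<eta> * real q + 1)"
      using card_long_window_le[OF window, of m "N div q + 1"]
      by linarith
    also have "\<dots> \<le> (2 * real N / real q) * (\<eta> * real q + 1)"
    proof (rule mult_right_mono)
      have "real (N div q) \<le> real N / real q" by (rule of_nat_div_le_of_nat)
      moreover have "1 \<le> real N / real q" using N \<open>q > 0\<close> by simp
      ultimately show "real (N div q + 1) \<le> 2 * real N / real q" by simp
    qed (use \<open>\<eta> \<ge> 0\<close> in simp)
    also have "\<dots> = 2 * (\<eta> + 1 / real q) * real N"
      using \<open>q > 0\<close> by (simp add: field_simps)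
    finally show ?thesis
      using N \<open>q > 0\<close> by (simp add: pos_divide_le_eq)
  qed
  then have "Max (range (\<lambda>m. real (card (J \<inter> {m + 1..m + N})) / real N)) \<le> 2 * (\<eta> + 1 / real q)"
    by (intro Max.boundedI finite_window_densities) blast+
  then show "ereal (Max (range (\<lambda>m. real (card (J \<inter> {m + 1..m + N})) / real N)))
      \<le> ereal (2 * (\<eta> + 1 / real q))"
    by (simp only: ereal_less_eq)
qed

lemma upper_Banach_density_multiples_pos:
  assumes "P \<ge> 1" and J: "\<And>j. j \<ge> 1 \<Longrightarrow> j * P \<in> J"
  shows "upper_Banach_density J > 0"
proof -
  have "ereal (1 / (2 * real P)) \<le> upper_Banach_density J"
    unfolding upper_Banach_density_def
  proof (rule le_Limsup, simp, unfold eventually_sequentially, intro exI allI impI)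
    fix N assume N: "P \<le> N"
    have "(\<lambda>j. j * P) ` {1..N div P} \<subseteq> J \<inter> {0 + 1..0 + N}"
    proof
      fix n assume "n \<in> (\<lambda>j. j * P) ` {1..N div P}"
      then have "\<exists>j. n = j * P \<and> 1 \<le> j \<and> j \<le> N div P" by auto
      then obtain j where j: "n = j * P" "1 \<le> j" "j \<le> N div P" by blast
      have "j * P \<le> N div P * P" using j(3) by simp
      also have "\<dots> \<le> N" by simp
      finally show "n \<in> J \<inter> {0 + 1..0 + N}" using J[OF j(2)] j(1,2) \<open>P \<ge> 1\<close> by simp
    qed
    then have "card ((\<lambda>j. j * P) ` {1..N div P}) \<le> card (J \<inter> {0 + 1..0 + N})"
      by (intro card_mono) auto
    moreover have "inj_on (\<lambda>j. j * P) {1..N div P}" using \<open>P \<ge> 1\<close> by (simp add: inj_on_def)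
    ultimately have "N div P \<le> card (J \<inter> {0 + 1..0 + N})" by (simp add: card_image)
    moreover have "N \<le> 2 * P * (N div P)"
    proof -
      have "N = P * (N div P) + N mod P" by simp
      moreover have "N mod P < P" using \<open>P \<ge> 1\<close> by simp
      moreover have "1 \<le> N div P" using N \<open>P \<ge> 1\<close> by (simp add: div_greater_zero_iff Suc_le_eq)
      then have "P * 1 \<le> P * (N div P)" by (rule mult_le_mono2)
      ultimately show ?thesis by linarith
    qed
    ultimately have "N \<le> 2 * P * card (J \<inter> {0 + 1..0 + N})"
      by (meson mult_le_mono2 order_trans)
    then have "real N \<le> 2 * real P * real (card (J \<inter> {0 + 1..0 + N}))"
      by (metis of_nat_le_iff of_nat_mult of_nat_numeral)
    then have "1 / (2 * real P) \<le> real (card (J \<inter> {0 + 1..0 + N})) / real N"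
      using \<open>P \<ge> 1\<close> N by (simp add: field_simps)
    also have "\<dots> \<le> Max (range (\<lambda>m. real (card (J \<inter> {m + 1..m + N})) / real N))"
      by (rule Max_ge[OF finite_window_densities rangeI])
    finally show "ereal (1 / (2 * real P))
      \<le> ereal (Max (range (\<lambda>m. real (card (J \<inter> {m + 1..m + N})) / real N)))" by simp
  qed
  moreover have "0 < ereal (1 / (2 * real P))" using \<open>P \<ge> 1\<close> by simp
  ultimately show ?thesis by (rule less_le_trans[rotated])
qed

lemma funpow_mult_fixed:
  assumes "(T ^^ P) x = x"
  shows "(T ^^ (j * P)) x = x"
  by (induction j) (simp_all add: funpow_add assms)

lemma periodic_in_RRec:
  assumes "P \<ge> 1" "(T ^^ P) x = x"
  shows "x \<in> RRec T"
proof -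
  have "(T ^^ (j * P)) x = x" for j
    by (rule funpow_mult_fixed[OF assms(2)])
  then show ?thesis
    unfolding RRec_def return_times_def using assms(1)
    by (auto intro!: upper_Banach_density_multiples_pos[of P] dest: subsetD[OF interior_subset])
qed

text \<open>
  By the mean value theorem sin(y/2) \<ge> (y/2) cos(y/2), hence sin y \<ge> y cos(y/2)^2 = y (1 + cos y)/2.
\<close>

lemma sin_ge_half:
  fixes y :: real
  assumes "0 \<le> y" "y \<le> pi / 2"
  shows "y / 2 \<le> sin y"
proof -
  have "y / 2 * cos (y / 2) \<le> sin (y / 2)"
  proof (cases "y = 0")
    case False
    then have "0 < y / 2" using assms by simp
    then obtain z where z: "0 < z" "z < y / 2" "sin (y / 2) - sin 0 = (y / 2 - 0) * cos z"
      using MVT2[of 0 "y / 2" sin cos] by (auto intro: derivative_intros)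
    moreover have "cos (y / 2) \<le> cos z"
      using z assms by (intro cos_monotone_0_pi_le) auto
    ultimately show ?thesis using assms by (simp add: mult_left_mono)
  qed simp
  moreover have "cos (y / 2) \<ge> 0" using assms by (intro cos_ge_zero) auto
  ultimately have "(y / 2 * cos (y / 2)) * cos (y / 2) \<le> sin (y / 2) * cos (y / 2)"
    by (rule mult_right_mono)
  then have "y * (cos (y / 2))\<^sup>2 \<le> sin y"
    using sin_double[of "y / 2"] by (simp add: power2_eq_square)
  moreover have "cos y \<ge> 0" using assms by (intro cos_ge_zero) auto
  then have "y * (1 / 2) \<le> y * (cos (y / 2))\<^sup>2"
    using cos_double_cos[of "y / 2"] assms by (intro mult_left_mono) auto
  ultimately show ?thesis by simp
qed

section \<open>Closed cyclic subspaces\<close>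

context scalar_banach_space begin

lemma poly_apply_extend:
  assumes "degree p \<le> n"
  shows "poly_apply scl p T x = (\<Sum>i\<le>n. scl (coeff p i) ((T ^^ i) x))"
  unfolding poly_apply_def using assms
  by (intro sum.mono_neutral_left) (auto simp: coeff_eq_0)

lemma poly_apply_add: "poly_apply scl (p + r) T x = poly_apply scl p T x + poly_apply scl r T x"
proof -
  define n where "n = max (degree p) (degree r)"
  have "degree p \<le> n" "degree r \<le> n" "degree (p + r) \<le> n"
    by (auto simp: n_def degree_add_le)
  then show ?thesis
    by (simp add: poly_apply_extend[of _ n] scale_left_distrib sum.distrib)
qed

lemma poly_apply_smult: "poly_apply scl (smult c p) T x = scl c (poly_apply scl p T x)"
  by (simp add: poly_apply_extend[of "smult c p" "degree p"] degree_smult_le poly_apply_def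
      scale_sum_right)

lemma poly_apply_one: "poly_apply scl 1 T x = x"
  by (simp add: poly_apply_def)

lemma poly_apply_shift:
  assumes "linear T" "\<And>c v. T (scl c v) = scl c (T v)"
  shows "poly_apply scl (pCons 0 p) T x = T (poly_apply scl p T x)"
proof -
  have "poly_apply scl (pCons 0 p) T x = (\<Sum>i\<le>Suc (degree p). scl (coeff (pCons 0 p) i) ((T ^^ i) x))"
    by (rule poly_apply_extend) (simp add: degree_pCons_le)
  also have "\<dots> = (\<Sum>i\<le>degree p. scl (coeff p i) (T ((T ^^ i) x)))"
    by (subst sum.atMost_Suc_shift) simp
  also have "\<dots> = T (poly_apply scl p T x)"
    by (simp add: poly_apply_def linear_sum[OF assms(1)] assms(2))
  finally show ?thesis .
qed

text \<open>
  For a bounded operator T over the scalar field this is the smallest closed T-invariant subspace containing x.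
\<close>

definition cyclic_subspace :: "('a \<Rightarrow> 'a) \<Rightarrow> 'a \<Rightarrow> 'a set" where
  "cyclic_subspace T x = closure (range (\<lambda>p. poly_apply scl p T x))"

lemma closed_cyclic_subspace: "closed (cyclic_subspace T x)"
  by (simp add: cyclic_subspace_def)

lemma generator_in_cyclic_subspace: "x \<in> cyclic_subspace T x"
  unfolding cyclic_subspace_def
  by (rule closure_subset[THEN subsetD]) (metis poly_apply_one rangeI)

lemma subspace_cyclic_subspace: "subspace (cyclic_subspace T x)"
proof (rule subspaceI)
  have zero: "poly_apply scl 0 T x = 0" by (simp add: poly_apply_def)
  show "0 \<in> cyclic_subspace T x"
    unfolding cyclic_subspace_def
    by (rule closure_subset[THEN subsetD]) (metis zero rangeI)
next
  fix u v assume "u \<in> cyclic_subspace T x" "v \<in> cyclic_subspace T x"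
  then obtain s t where s: "\<forall>n. s n \<in> range (\<lambda>p. poly_apply scl p T x)" "s \<longlonglongrightarrow> u"
    and t: "\<forall>n. t n \<in> range (\<lambda>p. poly_apply scl p T x)" "t \<longlonglongrightarrow> v"
    unfolding cyclic_subspace_def closure_sequential by (elim exE conjE)
  have "s n + t n \<in> range (\<lambda>p. poly_apply scl p T x)" for n
  proof -
    obtain p r where "s n = poly_apply scl p T x" "t n = poly_apply scl r T x"
      using s(1) t(1) by (meson imageE)
    then have "s n + t n = poly_apply scl (p + r) T x" by (simp add: poly_apply_add)
    then show ?thesis by (rule range_eqI)
  qed
  moreover have "(\<lambda>n. s n + t n) \<longlonglongrightarrow> u + v" by (rule tendsto_add[OF s(2) t(2)])
  ultimately show "u + v \<in> cyclic_subspace T x"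
    unfolding cyclic_subspace_def closure_sequential by (intro exI[of _ "\<lambda>n. s n + t n"]) simp
next
  fix c v assume "v \<in> cyclic_subspace T x"
  moreover have "scl c ` closure (range (\<lambda>p. poly_apply scl p T x))
      \<subseteq> closure (range (\<lambda>p. poly_apply scl p T x))"
  proof (rule image_closure_subset)
    show "continuous_on (closure (range (\<lambda>p. poly_apply scl p T x))) (scl c)"
      by (rule linear_continuous_on[OF bounded_linear_scale])
    have "scl c ` range (\<lambda>p. poly_apply scl p T x) \<subseteq> range (\<lambda>p. poly_apply scl p T x)"
    proof (rule image_subsetI)
      fix y assume "y \<in> range (\<lambda>p. poly_apply scl p T x)"
      then obtain p where "y = poly_apply scl p T x" by (rule imageE)
      then have "scl c y = poly_apply scl (smult c p) T x" by (simp add: poly_apply_smult)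
      then show "scl c y \<in> range (\<lambda>p. poly_apply scl p T x)" by (rule range_eqI)
    qed
    then show "scl c ` range (\<lambda>p. poly_apply scl p T x) \<subseteq> closure (range (\<lambda>p. poly_apply scl p T x))"
      using closure_subset by (rule subset_trans)
  qed simp
  ultimately show "scl c v \<in> cyclic_subspace T x"
    unfolding cyclic_subspace_def by blast
qed

lemma cyclic_subspace_invariant:
  assumes T: "bounded_linear T" "\<And>c v. T (scl c v) = scl c (T v)"
    and v: "v \<in> cyclic_subspace T x"
  shows "T v \<in> cyclic_subspace T x"
proof -
  have "T ` closure (range (\<lambda>p. poly_apply scl p T x)) \<subseteq> closure (range (\<lambda>p. poly_apply scl p T x))"
  proof (rule image_closure_subset)
    show "continuous_on (closure (range (\<lambda>p. poly_apply scl p T x))) T"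
      by (rule linear_continuous_on[OF T(1)])
    have "T ` range (\<lambda>p. poly_apply scl p T x) \<subseteq> range (\<lambda>p. poly_apply scl p T x)"
    proof (rule image_subsetI)
      fix y assume "y \<in> range (\<lambda>p. poly_apply scl p T x)"
      then obtain p where "y = poly_apply scl p T x" by (rule imageE)
      then have "T y = poly_apply scl (pCons 0 p) T x"
        by (simp only: poly_apply_shift[OF bounded_linear.linear[OF T(1)] T(2)])
      then show "T y \<in> range (\<lambda>p. poly_apply scl p T x)" by (rule range_eqI)
    qed
    then show "T ` range (\<lambda>p. poly_apply scl p T x) \<subseteq> closure (range (\<lambda>p. poly_apply scl p T x))"
      using closure_subset by (rule subset_trans)
  qed simp
  then show ?thesis using v unfolding cyclic_subspace_def by blast
qed

lemma cyclic_subspace_funpow_invariant: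
  assumes T: "bounded_linear T" "\<And>c v. T (scl c v) = scl c (T v)"
    and v: "v \<in> cyclic_subspace T x"
  shows "(T ^^ n) v \<in> cyclic_subspace T x"
  by (induction n) (simp_all add: v cyclic_subspace_invariant[OF T])

lemma scaleR_in_subspace: "subspace S \<Longrightarrow> v \<in> S \<Longrightarrow> r *\<^sub>R v \<in> S"
  unfolding scale_of_real[symmetric] by (rule subspace_scale)

lemma cyclic_vector_of_cyclic_subspace:
  assumes "cyclic_subspace T x = UNIV"
  shows "cyclic_vector scl T x"
  unfolding cyclic_vector_def
proof (intro allI impI)
  fix U :: "'a set" assume U: "open U \<and> U \<noteq> {}"
  then have "U \<inter> closure (range (\<lambda>p. poly_apply scl p T x)) \<noteq> {}"
    using assms by (simp add: cyclic_subspace_def)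
  then have "U \<inter> range (\<lambda>p. poly_apply scl p T x) \<noteq> {}"
    using U open_Int_closure_eq_empty by blast
  then show "\<exists>p. poly_apply scl p T x \<in> U" by auto
qed

end

section \<open>Infinite sums of planar rotations\<close>

lemma abs_cos_minus_one_le:
  fixes t :: real assumes "0 \<le> t" shows "\<bar>cos t - 1\<bar> \<le> t"
proof (cases "t = 0")
  case False
  then have "0 < t" using assms by simp
  then obtain z where "cos t - cos 0 = (t - 0) * - sin z"
    using MVT2[of 0 t cos "\<lambda>x. - sin x"] by (auto intro: derivative_intros)
  then have "\<bar>cos t - 1\<bar> = t * \<bar>sin z\<bar>" using assms by (simp add: abs_mult)
  also have "\<dots> \<le> t * 1" using assms by (intro mult_left_mono) auto
  finally show ?thesis by simp
qed simp

text \<open>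
  A biorthogonal system grouped in pairs (f k, g k) with coordinate functionals (fs k, gs k). The
  operator will rotate the k-th plane by a quarter turn divided by 2 ^ m k. The scaling is deliberately
  unbalanced: fs k is tiny although g k is bounded, so a rotation that moves a small multiple of g k onto
  the direction of f k makes the vector huge. The last assumption makes the angles so small that the
  rotations nevertheless differ from the identity by a summable amount.
\<close>

locale rotation_blocks = scalar_banach_space scl
  for scl :: "'k::real_normed_field \<Rightarrow> 'a::banach \<Rightarrow> 'a" +
  fixes f g :: "nat \<Rightarrow> 'a" and fs gs :: "nat \<Rightarrow> 'a \<Rightarrow> 'k" and m :: "nat \<Rightarrow> nat"
  assumes functional_fs: "functional (fs k)"
    and functional_gs: "functional (gs k)"
    and fs_f: "fs i (f j) = (if i = j then 1 else 0)"
    and gs_g: "gs i (g j) = (if i = j then 1 else 0)"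
    and fs_g: "fs i (g j) = 0"
    and gs_f: "gs i (f j) = 0"
    and dense_span: "closure (span (range f \<union> range g)) = UNIV"
    and strict_mono_m: "strict_mono m"
    and norm_fs_le: "norm (fs k x) \<le> (1 / 4) ^ k * norm x"
    and norm_g_le: "norm (g k) \<le> 1"
    and small_angle: "pi / 2 ^ (m k + 1) * (norm (fs k x) + norm (gs k x)) * (norm (f k) + norm (g k))
        \<le> (1 / 2) ^ k * norm x"
begin

definition angle :: "nat \<Rightarrow> real" where
  "angle k = pi / 2 ^ (m k + 1)"

text \<open>
  The difference between the rotation of the k-th plane and the identity, applied to the component of x
  in that plane.
\<close>

definition block_increment :: "nat \<Rightarrow> 'a \<Rightarrow> 'a" where
  "block_increment k x =
     scl ((cos (angle k) - 1) *\<^sub>R fs k x - sin (angle k) *\<^sub>R gs k x) (f k) +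
     scl (sin (angle k) *\<^sub>R fs k x + (cos (angle k) - 1) *\<^sub>R gs k x) (g k)"

definition T :: "'a \<Rightarrow> 'a" where
  "T x = x + (\<Sum>k. block_increment k x)"

lemma angle_pos: "0 < angle k"
  by (simp add: angle_def)

lemma bounded_linear_fs: "bounded_linear (fs k)" and bounded_linear_gs: "bounded_linear (gs k)"
  using functional_fs functional_gs by (auto simp: functional_def)

lemma fs_scl: "fs k (scl c x) = c * fs k x" and gs_scl: "gs k (scl c x) = c * gs k x"
  by (rule functional_scale[OF functional_fs], rule functional_scale[OF functional_gs])

lemma fs_add: "fs k (x + y) = fs k x + fs k y" and gs_add: "gs k (x + y) = gs k x + gs k y"
  by (rule functional_add[OF functional_fs], rule functional_add[OF functional_gs])

lemma fs_scaleR: "fs k (r *\<^sub>R x) = r *\<^sub>R fs k x" and gs_scaleR: "gs k (r *\<^sub>R x) = r *\<^sub>R gs k x"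
  by (simp_all add: linear_scale[OF bounded_linear.linear[OF bounded_linear_fs]]
        linear_scale[OF bounded_linear.linear[OF bounded_linear_gs]])

lemma norm_block_increment_le: "norm (block_increment k x) \<le> (1 / 2) ^ k * norm x"
proof -
  have c: "\<bar>cos (angle k) - 1\<bar> \<le> angle k"
    using angle_pos[of k] by (intro abs_cos_minus_one_le) simp
  have s: "\<bar>sin (angle k)\<bar> \<le> angle k"
    using abs_sin_x_le_abs_x[of "angle k"] angle_pos[of k] by simp
  have bounds: "\<bar>cos (angle k) - 1\<bar> * norm (fs k x) \<le> angle k * norm (fs k x)"
    "\<bar>cos (angle k) - 1\<bar> * norm (gs k x) \<le> angle k * norm (gs k x)"
    "\<bar>sin (angle k)\<bar> * norm (fs k x) \<le> angle k * norm (fs k x)"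
    "\<bar>sin (angle k)\<bar> * norm (gs k x) \<le> angle k * norm (gs k x)"
    using c s by (auto intro: mult_right_mono)
  have 1: "norm ((cos (angle k) - 1) *\<^sub>R fs k x - sin (angle k) *\<^sub>R gs k x)
      \<le> angle k * (norm (fs k x) + norm (gs k x))"
    using norm_triangle_ineq4[of "(cos (angle k) - 1) *\<^sub>R fs k x" "sin (angle k) *\<^sub>R gs k x"] bounds
    by (simp add: distrib_left)
  have 2: "norm (sin (angle k) *\<^sub>R fs k x + (cos (angle k) - 1) *\<^sub>R gs k x)
      \<le> angle k * (norm (fs k x) + norm (gs k x))"
    using norm_triangle_ineq[of "sin (angle k) *\<^sub>R fs k x" "(cos (angle k) - 1) *\<^sub>R gs k x"] bounds
    by (simp add: distrib_left)
  have "norm (block_increment k x)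
      \<le> angle k * (norm (fs k x) + norm (gs k x)) * norm (f k)
        + angle k * (norm (fs k x) + norm (gs k x)) * norm (g k)"
    unfolding block_increment_def using 1 2
    by (intro norm_triangle_le add_mono) (auto simp: norm_scale intro: mult_right_mono)
  also have "\<dots> = angle k * (norm (fs k x) + norm (gs k x)) * (norm (f k) + norm (g k))"
    by (simp add: distrib_left)
  also have "\<dots> \<le> (1 / 2) ^ k * norm x"
    unfolding angle_def by (rule small_angle)
  finally show ?thesis .
qed

lemma summable_block_increment_norm: "summable (\<lambda>k. norm (block_increment k x))"
  by (rule summable_comparison_test'[where g = "\<lambda>k. (1 / 2) ^ k * norm x"])
     (use norm_block_increment_le in \<open>auto intro: summable_mult2 summable_geometric\<close>)

lemma summable_block_increment: "summable (\<lambda>k. block_increment k x)"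
  by (rule summable_norm_cancel[OF summable_block_increment_norm])

lemma block_increment_add: "block_increment k (x + y) = block_increment k x + block_increment k y"
proof -
  have "(cos (angle k) - 1) *\<^sub>R fs k (x + y) - sin (angle k) *\<^sub>R gs k (x + y)
      = ((cos (angle k) - 1) *\<^sub>R fs k x - sin (angle k) *\<^sub>R gs k x)
        + ((cos (angle k) - 1) *\<^sub>R fs k y - sin (angle k) *\<^sub>R gs k y)"
    and "sin (angle k) *\<^sub>R fs k (x + y) + (cos (angle k) - 1) *\<^sub>R gs k (x + y)
      = (sin (angle k) *\<^sub>R fs k x + (cos (angle k) - 1) *\<^sub>R gs k x)
        + (sin (angle k) *\<^sub>R fs k y + (cos (angle k) - 1) *\<^sub>R gs k y)"
    by (simp_all add: fs_add gs_add scaleR_add_right)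
  then show ?thesis
    unfolding block_increment_def by (simp only: scale_left_distrib add_ac)
qed

lemma block_increment_scl: "block_increment k (scl c x) = scl c (block_increment k x)"
  by (simp add: block_increment_def fs_scl gs_scl scale_right_distrib
      right_diff_distrib distrib_left)

lemma T_scl: "T (scl c x) = scl c (T x)"
  unfolding T_def block_increment_scl
  by (simp add: bounded_linear.suminf[OF bounded_linear_scale summable_block_increment]
      scale_right_distrib)

lemma bounded_linear_T: "bounded_linear T"
proof (rule bounded_linear_intro[where K = 3])
  show "T (x + y) = T x + T y" for x y
    unfolding T_def block_increment_add
    by (simp add: suminf_add[OF summable_block_increment summable_block_increment, symmetric])
  show "T (r *\<^sub>R x) = r *\<^sub>R T x" for r x
    unfolding scale_of_real[symmetric] by (rule T_scl)
  show "norm (T x) \<le> norm x * 3" for x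
  proof -
    have "norm (\<Sum>k. block_increment k x) \<le> (\<Sum>k. norm (block_increment k x))"
      by (rule summable_norm[OF summable_block_increment_norm])
    also have "\<dots> \<le> (\<Sum>k. (1 / 2) ^ k * norm x)"
      by (intro suminf_le norm_block_increment_le summable_block_increment_norm
          summable_mult2 summable_geometric) simp
    also have "\<dots> = 2 * norm x"
      by (simp add: suminf_mult2[OF summable_geometric, symmetric] suminf_geometric)
    finally show ?thesis
      unfolding T_def using norm_triangle_ineq[of x "\<Sum>k. block_increment k x"] by linarith
  qed
qed

lemma is_operator_T: "is_operator scl T"
  unfolding is_operator_def
proof
  show "Vector_Spaces.linear scl scl T"
    by unfold_locales (simp_all add: T_scl linear_add[OF bounded_linear.linear[OF bounded_linear_T]])
  show "continuous_on UNIV T" by (rule linear_continuous_on[OF bounded_linear_T])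
qed

text \<open>
  A bounded functional passes through the infinite sum; if it sees a single plane, then it sees T as
  a single rotation.
\<close>

lemma functional_T:
  assumes "functional \<phi>" and "\<And>k. k \<noteq> j \<Longrightarrow> \<phi> (block_increment k x) = 0"
  shows "\<phi> (T x) = \<phi> x + \<phi> (block_increment j x)"
proof -
  have bl: "bounded_linear \<phi>" using assms(1) by (simp add: functional_def)
  have "\<phi> (\<Sum>k. block_increment k x) = (\<Sum>k. \<phi> (block_increment k x))"
    by (rule bounded_linear.suminf[OF bl summable_block_increment])
  also have "\<dots> = (\<Sum>k\<in>{j}. \<phi> (block_increment k x))"
    using assms(2) by (intro suminf_finite) auto
  finally show ?thesis unfolding T_def functional_add[OF assms(1)] by simp
qed

lemma fs_T: "fs k (T x) = cos (angle k) *\<^sub>R fs k x - sin (angle k) *\<^sub>R gs k x"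
proof -
  have "fs k (T x) = fs k x + fs k (block_increment k x)"
    by (rule functional_T[OF functional_fs]) (simp add: block_increment_def fs_add fs_scl fs_f fs_g)
  then show ?thesis
    by (simp add: block_increment_def fs_add fs_scl fs_f fs_g scaleR_left_diff_distrib)
qed

lemma gs_T: "gs k (T x) = sin (angle k) *\<^sub>R fs k x + cos (angle k) *\<^sub>R gs k x"
proof -
  have "gs k (T x) = gs k x + gs k (block_increment k x)"
    by (rule functional_T[OF functional_gs]) (simp add: block_increment_def gs_add gs_scl gs_f gs_g)
  then show ?thesis
    by (simp add: block_increment_def gs_add gs_scl gs_f gs_g scaleR_left_diff_distrib)
qed

lemma coordinates_funpow_T:
  "fs k ((T ^^ n) x) = cos (n * angle k) *\<^sub>R fs k x - sin (n * angle k) *\<^sub>R gs k x"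
  "gs k ((T ^^ n) x) = sin (n * angle k) *\<^sub>R fs k x + cos (n * angle k) *\<^sub>R gs k x"
proof (induction n)
  case (Suc n)
  {
    case 1
    show ?case
      by (simp add: fs_T Suc distrib_right cos_add sin_add algebra_simps)
  next
    case 2
    show ?case
      by (simp add: gs_T Suc distrib_right cos_add sin_add algebra_simps)
  }
qed simp_all

text \<open>
  The k-th real plane is identified with the complex plane, so that T acts on it as the multiplication
  by a complex number of modulus 1.
\<close>

definition planar :: "nat \<Rightarrow> complex \<Rightarrow> 'a" where
  "planar k z = Re z *\<^sub>R f k + Im z *\<^sub>R g k"

lemma T_planar: "T (planar k z) = planar k (cis (angle k) * z)"
proof -
  have coord: "fs j (planar k z) = (if j = k then of_real (Re z) else 0)"
    "gs j (planar k z) = (if j = k then of_real (Im z) else 0)" for j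
    by (auto simp: planar_def fs_add gs_add fs_scaleR gs_scaleR fs_f fs_g gs_f gs_g
        scaleR_conv_of_real)
  have zero: "block_increment j (planar k z) = 0" if "j \<noteq> k" for j
    using that by (simp add: block_increment_def coord)
  have "(\<Sum>j. block_increment j (planar k z)) = (\<Sum>j\<in>{k}. block_increment j (planar k z))"
    using zero by (intro suminf_finite) auto
  then have "T (planar k z) = planar k z
      + scl (of_real ((cos (angle k) - 1) * Re z - sin (angle k) * Im z)) (f k)
      + scl (of_real (sin (angle k) * Re z + (cos (angle k) - 1) * Im z)) (g k)"
    by (simp add: T_def block_increment_def coord scaleR_conv_of_real)
  then show ?thesis
    unfolding scale_of_real by (simp add: planar_def algebra_simps)
qed

lemma funpow_T_planar: "(T ^^ n) (planar k z) = planar k (cis (n * angle k) * z)"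
proof (induction n)
  case (Suc n)
  then show ?case
    by (simp add: T_planar mult.assoc[symmetric] cis_mult algebra_simps)
qed simp

end

context rotation_blocks begin

section \<open>Periodic vectors\<close>

lemma bounded_linear_funpow_T: "bounded_linear (T ^^ n)"
proof (induction n)
  case (Suc n)
  show ?case
    using bounded_linear_compose[OF bounded_linear_T Suc] by (simp add: o_def)
qed (simp add: id_def bounded_linear_ident)

lemma funpow_T_scl: "(T ^^ n) (scl c x) = scl c ((T ^^ n) x)"
  by (induction n) (simp_all add: T_scl)

lemma f_planar: "f k = planar k 1" and g_planar: "g k = planar k \<i>"
  by (simp_all add: planar_def)

lemma planar_periodic: "(T ^^ (2 ^ (m k + 2))) (planar k z) = planar k z"
proof -
  have "real (2 ^ (m k + 2)) * angle k = 2 * pi"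
    by (simp add: angle_def power_add)
  then show ?thesis by (simp only: funpow_T_planar cis_2pi mult_1)
qed

lemma subspace_periodic: "subspace {x. \<exists>P\<ge>1. (T ^^ P) x = x}"
proof (rule subspaceI)
  show "0 \<in> {x. \<exists>P\<ge>1. (T ^^ P) x = x}"
    using linear_0[OF bounded_linear.linear[OF bounded_linear_funpow_T[of 1]]] by auto
next
  fix x y assume "x \<in> {x. \<exists>P\<ge>1. (T ^^ P) x = x}" "y \<in> {x. \<exists>P\<ge>1. (T ^^ P) x = x}"
  then obtain P Q where PQ: "P \<ge> 1" "(T ^^ P) x = x" "Q \<ge> 1" "(T ^^ Q) y = y" by blast
  have "(T ^^ (P * Q)) x = x"
    using funpow_mult_fixed[OF PQ(2), of Q] by (simp add: mult.commute)
  moreover have "(T ^^ (P * Q)) y = y"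
    by (rule funpow_mult_fixed[OF PQ(4)])
  ultimately have "(T ^^ (P * Q)) (x + y) = x + y"
    by (simp add: linear_add[OF bounded_linear.linear[OF bounded_linear_funpow_T]])
  moreover have "P * Q \<ge> 1" using PQ by simp
  ultimately show "x + y \<in> {x. \<exists>P\<ge>1. (T ^^ P) x = x}" by blast
next
  fix c x assume "x \<in> {x. \<exists>P\<ge>1. (T ^^ P) x = x}"
  then show "scl c x \<in> {x. \<exists>P\<ge>1. (T ^^ P) x = x}"
    by (auto simp: funpow_T_scl)
qed

text \<open>
  Each plane is rotated by a rational multiple of a full turn, so all its vectors are periodic; finite
  sums of periodic vectors are periodic, and they are dense.
\<close>

lemma reiteratively_recurrent_T: "reiteratively_recurrent T"
proof -
  have "range f \<union> range g \<subseteq> {x. \<exists>P\<ge>1. (T ^^ P) x = x}"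
  proof -
    have "\<exists>P\<ge>1. (T ^^ P) (planar k z) = planar k z" for k z
      using planar_periodic[of k z] by (intro exI[of _ "2 ^ (m k + 2)"]) simp
    then show ?thesis by (auto simp: f_planar g_planar)
  qed
  then have "span (range f \<union> range g) \<subseteq> {x. \<exists>P\<ge>1. (T ^^ P) x = x}"
    by (rule span_minimal[OF _ subspace_periodic])
  also have "\<dots> \<subseteq> RRec T" using periodic_in_RRec[of _ T] by blast
  finally show ?thesis
    unfolding reiteratively_recurrent_def using closure_mono dense_span by blast
qed

section \<open>Generic vectors return rarely\<close>

text \<open>
  Vectors whose g-coordinate in some plane from the K-th on exceeds the threshold (1/2)^k. The
  threshold tends to 0, which makes these sets dense, yet it is far above the size (1/4)^k of the functional fs k, which
  makes the rotation of such a coordinate visible.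
\<close>

definition excited :: "nat \<Rightarrow> 'a set" where
  "excited K = {x. \<exists>k\<ge>K. (1 / 2) ^ k < norm (gs k x)}"

lemma open_excited: "open (excited K)"
proof -
  have "excited K = (\<Union>k\<in>{K..}. {x. (1 / 2) ^ k < norm (gs k x)})"
    by (auto simp: excited_def)
  also have "open \<dots>"
    by (intro open_UN ballI open_Collect_less continuous_intros
        linear_continuous_on[OF bounded_linear_gs])
  finally show ?thesis .
qed

text \<open>
  If the g-coordinate of x is below the threshold, then adding three times the threshold along g k lifts
  it above; the perturbation is small because g k has norm at most 1.
\<close>

lemma dense_excited: "closure (excited K) = UNIV"
proof -
  have "\<exists>y\<in>excited K. dist y x < \<epsilon>" if "\<epsilon> > 0" for x \<epsilon>
  proof -
    obtain n where n: "(1 / 2) ^ n < \<epsilon> / 3"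
      using real_arch_pow_inv[of "\<epsilon> / 3" "1 / 2"] \<open>\<epsilon> > 0\<close> by auto
    define k where "k = max K n"
    have "(1 / 2 :: real) ^ k \<le> (1 / 2) ^ n"
      by (intro power_decreasing) (auto simp: k_def)
    then have k: "(1 / 2) ^ k < \<epsilon> / 3" "k \<ge> K"
      using n by linarith (simp add: k_def)
    show ?thesis
    proof (cases "(1 / 2) ^ k < norm (gs k x)")
      case True
      then show ?thesis using k(2) \<open>\<epsilon> > 0\<close> by (intro bexI[of _ x]) (auto simp: excited_def)
    next
      case False
      define y where "y = x + (3 * (1 / 2) ^ k) *\<^sub>R g k"
      have "gs k y = gs k x + of_real (3 * (1 / 2) ^ k)"
        by (simp add: y_def gs_add gs_scaleR gs_g scaleR_conv_of_real)
      then have "norm (of_real (3 * (1 / 2) ^ k) :: 'k) \<le> norm (gs k y) + norm (gs k x)"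
        using norm_triangle_ineq4[of "gs k y" "gs k x"] by simp
      then have "3 * (1 / 2) ^ k \<le> norm (gs k y) + norm (gs k x)"
        unfolding norm_of_real by simp
      moreover have "0 < (1 / 2 :: real) ^ k" by simp
      ultimately have "(1 / 2) ^ k < norm (gs k y)"
        using False by linarith
      then have "y \<in> excited K" using k(2) by (auto simp: excited_def)
      moreover have "dist y x = 3 * (1 / 2) ^ k * norm (g k)"
        by (simp add: y_def dist_norm)
      then have "dist y x \<le> 3 * (1 / 2) ^ k * 1"
        using norm_g_le[of k] by (simp only:) (intro mult_left_mono, auto)
      then have "dist y x < \<epsilon>" using k(1) by linarith
      ultimately show ?thesis by blast
    qed
  qed
  then show ?thesis by (auto simp: closure_approachable)
qed

text \<open>
  Two values a cos s - b sin s and a cos t - b sin t of a sinusoid determine its coefficient b: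
  eliminating a gives b sin(t - s). If both values are small while b is not, then sin(t - s) is small, and for times
  that differ by less than a quarter turn this means that they are close together.
\<close>

lemma return_gap_le:
  assumes "norm (fs k ((T ^^ i) x)) \<le> \<epsilon>" "norm (fs k ((T ^^ j) x)) \<le> \<epsilon>"
    and "i < j" "j < i + 2 ^ m k"
  shows "real (j - i) * norm (gs k x) \<le> 4 * \<epsilon> * 2 ^ m k"
proof -
  define s where "s = real i * angle k"
  define t where "t = real j * angle k"
  define y where "y = real (j - i) * angle k"
  have y: "y = t - s" using \<open>i < j\<close> by (simp add: y_def s_def t_def of_nat_diff algebra_simps)
  have "cos t *\<^sub>R fs k ((T ^^ i) x) - cos s *\<^sub>R fs k ((T ^^ j) x) = sin y *\<^sub>R gs k x"
    unfolding coordinates_funpow_T s_def[symmetric] t_def[symmetric] y sin_diff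
    by (simp add: scaleR_right_diff_distrib scaleR_left_diff_distrib mult.commute)
  then have "\<bar>sin y\<bar> * norm (gs k x)
      = norm (cos t *\<^sub>R fs k ((T ^^ i) x) - cos s *\<^sub>R fs k ((T ^^ j) x))"
    by simp
  also have "\<dots> \<le> \<bar>cos t\<bar> * norm (fs k ((T ^^ i) x)) + \<bar>cos s\<bar> * norm (fs k ((T ^^ j) x))"
    using norm_triangle_ineq4[of "cos t *\<^sub>R fs k ((T ^^ i) x)" "cos s *\<^sub>R fs k ((T ^^ j) x)"]
    by simp
  also have "\<dots> \<le> 1 * \<epsilon> + 1 * \<epsilon>"
    using assms(1,2) by (intro add_mono mult_mono) auto
  finally have sin_y: "\<bar>sin y\<bar> * norm (gs k x) \<le> 2 * \<epsilon>" by simp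
  have y_eq: "y = real (j - i) / 2 ^ m k * (pi / 2)"
    by (simp add: y_def angle_def)
  have "j - i \<le> 2 ^ m k" using assms(4) by linarith
  then have "real (j - i) \<le> 2 ^ m k" by (metis of_nat_le_iff of_nat_numeral of_nat_power)
  then have frac: "real (j - i) / 2 ^ m k \<le> 1" by simp
  have "y / 2 \<le> sin y"
  proof (rule sin_ge_half)
    show "0 \<le> y" by (simp add: y_eq)
    show "y \<le> pi / 2" unfolding y_eq using frac by (intro mult_left_le_one_le) auto
  qed
  moreover have "real (j - i) / 2 ^ m k * 1 \<le> y"
    unfolding y_eq using pi_ge_two by (intro mult_left_mono) auto
  then have "real (j - i) / 2 ^ m k / 2 \<le> y / 2" by simp
  ultimately have "real (j - i) / 2 ^ m k / 2 \<le> \<bar>sin y\<bar>"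
    using abs_ge_self[of "sin y"] by (meson order_trans)
  then have "real (j - i) / 2 ^ m k / 2 * norm (gs k x) \<le> \<bar>sin y\<bar> * norm (gs k x)"
    by (rule mult_right_mono) simp
  then have "real (j - i) / 2 ^ m k / 2 * norm (gs k x) \<le> 2 * \<epsilon>" using sin_y by linarith
  then show ?thesis by (simp add: field_simps)
qed

text \<open>
  At a return time to the unit ball around x the orbit has norm at most norm x + 1, so its coordinate
  under fs k is at most (1/4)^k (norm x + 1). If the g-coordinate exceeds (1/2)^k, return times within a
  quarter turn can only cluster in a proportion of order (1/2)^k of it.
\<close>

lemma return_density_le:
  assumes "(1 / 2) ^ k < norm (gs k x)"
  shows "upper_Banach_density (return_times T x (ball x 1)) \<le> ereal ((8 * norm x + 10) * (1 / 2) ^ k)"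
proof -
  define C where "C = norm x + 1"
  define J where "J = return_times T x (ball x 1)"
  define \<eta> where "\<eta> = 4 * C * (1 / 2) ^ k"
  have C: "C > 0" by (simp add: C_def add_nonneg_pos)
  have small: "norm (fs k ((T ^^ n) x)) \<le> (1 / 4) ^ k * C" if "n \<in> J" for n
  proof -
    have "norm ((T ^^ n) x - x) < 1"
      using that by (simp add: J_def return_times_def dist_norm norm_minus_commute)
    then have "norm ((T ^^ n) x) \<le> C"
      unfolding C_def using norm_triangle_ineq2[of "(T ^^ n) x" x] by linarith
    then have "(1 / 4) ^ k * norm ((T ^^ n) x) \<le> (1 / 4) ^ k * C"
      by (intro mult_left_mono) auto
    then show ?thesis using norm_fs_le[of k "(T ^^ n) x"] by linarith
  qed
  have quarter: "(1 / 4 :: real) ^ k = (1 / 2) ^ k * (1 / 2) ^ k"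
    by (simp add: power_mult_distrib[symmetric])
  have gap: "real (j - i) \<le> \<eta> * real (2 ^ m k)"
    if "i \<in> J" "j \<in> J" "i < j" "j < i + 2 ^ m k" for i j
  proof -
    have "real (j - i) * (1 / 2) ^ k \<le> real (j - i) * norm (gs k x)"
      using assms by (intro mult_left_mono) auto
    also have "\<dots> \<le> 4 * ((1 / 4) ^ k * C) * 2 ^ m k"
      using small that by (intro return_gap_le) auto
    also have "\<dots> = \<eta> * real (2 ^ m k) * (1 / 2) ^ k"
      by (simp add: \<eta>_def quarter)
    finally show ?thesis by (rule mult_right_le_imp_le) simp
  qed
  have "upper_Banach_density J \<le> ereal (2 * (\<eta> + 1 / real (2 ^ m k)))"
    using C by (intro upper_Banach_density_le gap) (auto simp: \<eta>_def)
  also have "\<dots> \<le> ereal ((8 * norm x + 10) * (1 / 2) ^ k)"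
  proof -
    \<comment> \<open>the remaining term 1 / 2 ^ m k is absorbed since m k is at least k\<close>
    have "k \<le> m k" by (rule strict_mono_imp_increasing[OF strict_mono_m])
    then have "(1 / 2 :: real) ^ m k \<le> (1 / 2) ^ k" by (intro power_decreasing) auto
    then show ?thesis by (simp add: \<eta>_def C_def power_one_over algebra_simps)
  qed
  finally show ?thesis by (simp add: J_def)
qed

text \<open>
  A vector in the intersection of the dense open sets of excited vectors is excited in infinitely many
  planes, so its return times to the unit ball around it have upper Banach density 0.
\<close>

lemma meager_RRec_T: "meager (RRec T)"
proof -
  have sub: "RRec T \<inter> (\<Inter>K. excited K) = {}"
  proof (rule ccontr)
    assume "RRec T \<inter> (\<Inter>K. excited K) \<noteq> {}"
    then obtain x where x: "x \<in> RRec T" "\<And>K. x \<in> excited K" by blast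
    define D where "D = upper_Banach_density (return_times T x (ball x 1))"
    have bound: "D \<le> ereal ((8 * norm x + 10) * (1 / 2) ^ K)" for K
    proof -
      obtain k where k: "k \<ge> K" "(1 / 2) ^ k < norm (gs k x)"
        using x(2)[of K] by (auto simp: excited_def)
      have "D \<le> ereal ((8 * norm x + 10) * (1 / 2) ^ k)"
        unfolding D_def by (rule return_density_le[OF k(2)])
      also have "(8 * norm x + 10) * (1 / 2) ^ k \<le> (8 * norm x + 10) * (1 / 2) ^ K"
        using k(1) by (intro mult_left_mono power_decreasing) auto
      finally show ?thesis by simp
    qed
    have "(\<lambda>K. ereal ((8 * norm x + 10) * (1 / 2) ^ K)) \<longlonglongrightarrow> ereal ((8 * norm x + 10) * 0)"
      by (intro tendsto_ereal tendsto_mult tendsto_const LIMSEQ_power_zero) simp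
    then have "D \<le> ereal ((8 * norm x + 10) * 0)"
      by (rule LIMSEQ_le_const) (use bound in blast)
    moreover have "x \<in> interior (ball x 1)" by (simp add: interior_open)
    then have "D > 0" using x(1) unfolding RRec_def D_def by blast
    ultimately show False by (simp add: zero_ereal_def[symmetric])
  qed
  define \<F> where "\<F> = range (\<lambda>K. RRec T - excited K)"
  have "nowhere_dense (RRec T - excited K)" for K
  proof -
    have "closure (RRec T - excited K) \<subseteq> - excited K"
      by (rule closure_minimal) (auto simp: open_excited closed_Compl)
    then have "interior (closure (RRec T - excited K)) \<subseteq> interior (- excited K)"
      by (rule interior_mono)
    also have "\<dots> = {}" by (simp add: interior_complement dense_excited)
    finally show ?thesis by (simp add: nowhere_dense_def)
  qed
  moreover have "RRec T = \<Union>\<F>" using sub by (auto simp: \<F>_def)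
  moreover have "countable \<F>" by (simp add: \<F>_def)
  ultimately show ?thesis unfolding meager_def \<F>_def by blast
qed

end

section \<open>Cyclicity of the rotation operator\<close>

context rotation_blocks begin

text \<open>
  The weights make every bounded choice of planar components summable.
\<close>

definition weight :: "nat \<Rightarrow> real" where
  "weight k = (1 / 2) ^ k / (norm (f k) + norm (g k) + 1)"

definition combine :: "(nat \<Rightarrow> complex) \<Rightarrow> 'a" where
  "combine z = (\<Sum>k. weight k *\<^sub>R planar k (z k))"

lemma weight_pos: "0 < weight k"
  unfolding weight_def by (intro divide_pos_pos add_nonneg_pos) auto

lemma norm_weighted_planar_le:
  assumes "cmod z \<le> 1"
  shows "norm (weight k *\<^sub>R planar k z) \<le> (1 / 2) ^ k"
proof -
  have "norm (planar k z) \<le> \<bar>Re z\<bar> * norm (f k) + \<bar>Im z\<bar> * norm (g k)"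
    unfolding planar_def using norm_triangle_ineq[of "Re z *\<^sub>R f k" "Im z *\<^sub>R g k"] by simp
  also have "\<dots> \<le> 1 * norm (f k) + 1 * norm (g k)"
    using assms abs_Re_le_cmod[of z] abs_Im_le_cmod[of z]
    by (intro add_mono mult_right_mono) auto
  finally have n: "norm (planar k z) \<le> norm (f k) + norm (g k) + 1" by simp
  have "norm (weight k *\<^sub>R planar k z) = weight k * norm (planar k z)"
    using weight_pos[of k] by simp
  also have "\<dots> \<le> weight k * (norm (f k) + norm (g k) + 1)"
    using n weight_pos[of k] by (intro mult_left_mono) auto
  also have "\<dots> = (1 / 2) ^ k"
  proof -
    have "norm (f k) + norm (g k) + 1 > 0" by (intro add_nonneg_pos) auto
    then show ?thesis by (simp add: weight_def)
  qed
  finally show ?thesis .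
qed

lemma summable_weighted_planar_norm:
  assumes "\<And>k. cmod (z k) \<le> 1"
  shows "summable (\<lambda>k. norm (weight k *\<^sub>R planar k (z k)))"
proof (rule summable_comparison_test'[where g = "\<lambda>k. (1 / 2) ^ k" and N = 0])
  show "summable (\<lambda>k. (1 / 2 :: real) ^ k)" by (rule summable_geometric) simp
  show "norm (norm (weight n *\<^sub>R planar n (z n))) \<le> (1 / 2) ^ n" for n
    unfolding real_norm_def abs_norm_cancel by (rule norm_weighted_planar_le[OF assms])
qed

lemma summable_weighted_planar:
  assumes "\<And>k. cmod (z k) \<le> 1"
  shows "summable (\<lambda>k. weight k *\<^sub>R planar k (z k))"
  by (rule summable_norm_cancel[OF summable_weighted_planar_norm[OF assms]])

lemma funpow_T_combine:
  assumes "\<And>k. cmod (z k) \<le> 1"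
  shows "(T ^^ n) (combine z) = combine (\<lambda>k. cis (n * angle k) * z k)"
  unfolding combine_def bounded_linear.suminf[OF bounded_linear_funpow_T summable_weighted_planar[OF assms]]
  by (simp add: linear_scale[OF bounded_linear.linear[OF bounded_linear_funpow_T]] funpow_T_planar)

lemma combine_average:
  assumes "\<And>k. cmod (z k) \<le> 1" "\<And>k. cmod (w k) \<le> 1"
  shows "combine (\<lambda>k. (z k + w k) / 2) = (1 / 2) *\<^sub>R (combine z + combine w)"
proof -
  note sz = summable_weighted_planar[OF assms(1)] and sw = summable_weighted_planar[OF assms(2)]
  have "(1 / 2) *\<^sub>R (combine z + combine w)
      = (1 / 2) *\<^sub>R (\<Sum>k. weight k *\<^sub>R planar k (z k) + weight k *\<^sub>R planar k (w k))"
    unfolding combine_def by (simp only: suminf_add[OF sz sw])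
  also have "\<dots> = (\<Sum>k. (1 / 2) *\<^sub>R (weight k *\<^sub>R planar k (z k) + weight k *\<^sub>R planar k (w k)))"
    by (rule bounded_linear.suminf[OF bounded_linear_scaleR_right summable_add[OF sz sw]])
  also have "\<dots> = combine (\<lambda>k. (z k + w k) / 2)"
    unfolding combine_def planar_def
    by (intro suminf_cong) (simp add: scaleR_add_right scaleR_add_left add_divide_distrib)
  finally show ?thesis by simp
qed

text \<open>
  The operator (I + T ^^ h) / 2, where h = 2 ^ (m L + 1) is half of the period of the L-th plane, kills
  that plane and fixes all earlier ones, because h is a multiple of their periods. The filter symbol is
  the factor by which the product of these operators over K \<le> L < M acts on the k-th plane.
\<close>

definition filter_symbol :: "nat \<Rightarrow> nat \<Rightarrow> nat \<Rightarrow> complex" where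
  "filter_symbol K M k = (\<Prod>L\<in>{K..<M}. (1 + cis (real (2 ^ (m L + 1)) * angle k)) / 2)"

lemma norm_average_cis_le: "cmod ((1 + cis t) / 2) \<le> 1"
  using norm_triangle_ineq[of 1 "cis t"] by (simp add: norm_divide)

lemma norm_filter_symbol_le: "cmod (filter_symbol K M k) \<le> 1"
  unfolding filter_symbol_def prod_norm[symmetric]
  by (intro prod_le_1 conjI norm_ge_zero norm_average_cis_le)

lemma half_period_angle:
  assumes "k \<le> L"
  shows "real (2 ^ (m L + 1)) * angle k = 2 ^ (m L - m k) * pi"
proof -
  have "m k \<le> m L" using strict_mono_m assms by (simp add: strict_mono_less_eq)
  then have "(2 :: real) ^ (m L + 1) = 2 ^ (m L - m k) * 2 ^ (m k + 1)"
    by (simp add: power_add[symmetric])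
  then show ?thesis by (simp add: angle_def)
qed

lemma filter_symbol_low:
  assumes "k < K"
  shows "filter_symbol K M k = 1"
  unfolding filter_symbol_def
proof (rule prod.neutral, rule ballI)
  fix L assume L: "L \<in> {K..<M}"
  then have "m k < m L" using strict_mono_m assms by (auto simp: strict_mono_less)
  then obtain d where d: "m L - m k = Suc d" by (metis Suc_diff_Suc)
  have "real (2 ^ (m L + 1)) * angle k = 2 * pi * real (2 ^ d)"
    using half_period_angle[of k L] L assms by (simp add: d)
  moreover have "cis (2 * pi * real (2 ^ d)) = 1"
    by (rule cis_multiple_2pi) (rule Ints_of_nat)
  ultimately have "cis (real (2 ^ (m L + 1)) * angle k) = 1" by (simp only:)
  then show "(1 + cis (real (2 ^ (m L + 1)) * angle k)) / 2 = 1" by (simp only:) simp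
qed

lemma filter_symbol_middle:
  assumes "K \<le> k" "k < M"
  shows "filter_symbol K M k = 0"
  unfolding filter_symbol_def
proof (rule prod_zero)
  show "\<exists>L\<in>{K..<M}. (1 + cis (real (2 ^ (m L + 1)) * angle k)) / 2 = 0"
    using assms half_period_angle[of k k] by (intro bexI[of _ k]) auto
qed simp

definition seed :: 'a where
  "seed = combine (\<lambda>_. 1)"

text \<open>
  Multiplying in one further factor replaces a vector v by (v + (T ^^ h) v) / 2, which stays in every
  T-invariant subspace.
\<close>

lemma combine_filter_in_cyclic_subspace:
  assumes "K \<le> M"
  shows "combine (filter_symbol K M) \<in> cyclic_subspace T seed"
  using assms
proof (induction M rule: dec_induct)
  case base
  have "filter_symbol K K = (\<lambda>_. 1)" by (simp add: filter_symbol_def fun_eq_iff)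
  then show ?case
    using generator_in_cyclic_subspace[of seed T] by (simp add: seed_def)
next
  case (step M)
  define t where "t k = real (2 ^ (m M + 1)) * angle k" for k
  define z where "z = filter_symbol K M"
  have z: "cmod (z k) \<le> 1" for k by (simp add: z_def norm_filter_symbol_le)
  have w: "cmod (cis (t k) * z k) \<le> 1" for k using z[of k] by (simp add: norm_mult)
  have "filter_symbol K (Suc M) = (\<lambda>k. (z k + cis (t k) * z k) / 2)"
    using step.hyps by (simp add: filter_symbol_def z_def t_def fun_eq_iff algebra_simps)
  then have "combine (filter_symbol K (Suc M)) = (1 / 2) *\<^sub>R (combine z + combine (\<lambda>k. cis (t k) * z k))"
    by (simp only: combine_average[OF z w])
  also have "combine (\<lambda>k. cis (t k) * z k) = (T ^^ (2 ^ (m M + 1))) (combine z)"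
    unfolding t_def by (rule funpow_T_combine[OF z, symmetric])
  finally have "combine (filter_symbol K (Suc M))
      = (1 / 2) *\<^sub>R (combine z + (T ^^ (2 ^ (m M + 1))) (combine z))" .
  moreover have "combine z \<in> cyclic_subspace T seed" using step.IH by (simp add: z_def)
  moreover from this have "(T ^^ (2 ^ (m M + 1))) (combine z) \<in> cyclic_subspace T seed"
    by (rule cyclic_subspace_funpow_invariant[OF bounded_linear_T T_scl])
  ultimately show ?case
    using subspace_add[OF subspace_cyclic_subspace] scaleR_in_subspace[OF subspace_cyclic_subspace]
    by simp
qed

text \<open>
  The filter leaves the planes below K untouched and annihilates those between K and M. On the planes
  from M on nothing is known except that the filter does not expand, but there the weights are
  small.
\<close>

lemma norm_combine_filter_le:
  assumes "K \<le> M"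
  shows "norm (combine (filter_symbol K M) - (\<Sum>k<K. weight k *\<^sub>R f k)) \<le> 2 * (1 / 2) ^ M"
proof -
  define a where "a k = weight k *\<^sub>R planar k (filter_symbol K M k)" for k
  have sum: "summable (\<lambda>k. norm (a k))"
    unfolding a_def by (rule summable_weighted_planar_norm[OF norm_filter_symbol_le])
  then have tail: "summable (\<lambda>k. norm (a (k + M)))" by (rule summable_ignore_initial_segment)
  have "combine (filter_symbol K M) = (\<Sum>k. a (k + M)) + (\<Sum>k<M. a k)"
    unfolding combine_def a_def[symmetric]
    by (rule suminf_split_initial_segment[OF summable_norm_cancel[OF sum]])
  moreover have "(\<Sum>k<M. a k) = (\<Sum>k<K. weight k *\<^sub>R f k)"
  proof -
    have "(\<Sum>k<M. a k) = (\<Sum>k<K. a k)"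
      using assms
      by (intro sum.mono_neutral_right) (auto simp: a_def filter_symbol_middle planar_def)
    also have "\<dots> = (\<Sum>k<K. weight k *\<^sub>R f k)"
      by (intro sum.cong) (auto simp: a_def filter_symbol_low planar_def)
    finally show ?thesis .
  qed
  ultimately have "norm (combine (filter_symbol K M) - (\<Sum>k<K. weight k *\<^sub>R f k))
      = norm (\<Sum>k. a (k + M))" by simp
  also have "\<dots> \<le> (\<Sum>k. norm (a (k + M)))" by (rule summable_norm[OF tail])
  also have "\<dots> \<le> (\<Sum>k. (1 / 2) ^ k * (1 / 2) ^ M)"
  proof (rule suminf_le[OF _ tail])
    show "norm (a (k + M)) \<le> (1 / 2) ^ k * (1 / 2) ^ M" for k
      unfolding a_def power_add[symmetric]
      by (rule norm_weighted_planar_le[OF norm_filter_symbol_le])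
    show "summable (\<lambda>k. (1 / 2 :: real) ^ k * (1 / 2) ^ M)"
      by (intro summable_mult2 summable_geometric) simp
  qed
  also have "\<dots> = 2 * (1 / 2) ^ M"
    by (simp add: suminf_mult2[OF summable_geometric, symmetric] suminf_geometric)
  finally show ?thesis .
qed

lemma partial_seed_in_cyclic_subspace: "(\<Sum>k<K. weight k *\<^sub>R f k) \<in> cyclic_subspace T seed"
proof (rule Lim_in_closed_set[OF closed_cyclic_subspace])
  show "\<forall>\<^sub>F M in sequentially. combine (filter_symbol K M) \<in> cyclic_subspace T seed"
    using combine_filter_in_cyclic_subspace by (auto simp: eventually_sequentially)
  show "(\<lambda>M. combine (filter_symbol K M)) \<longlonglongrightarrow> (\<Sum>k<K. weight k *\<^sub>R f k)"
  proof (rule LIM_zero_cancel, rule Lim_null_comparison)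
    show "\<forall>\<^sub>F M in sequentially.
        norm (combine (filter_symbol K M) - (\<Sum>k<K. weight k *\<^sub>R f k)) \<le> 2 * (1 / 2) ^ M"
      using norm_combine_filter_le by (auto simp: eventually_sequentially)
    show "(\<lambda>M. 2 * (1 / 2 :: real) ^ M) \<longlonglongrightarrow> 0"
      by (intro tendsto_mult_right_zero LIMSEQ_power_zero) simp
  qed
qed simp

text \<open>
  Partial sums of the seed lie in its closed cyclic subspace, hence so do their differences, multiples of the
  vectors f k. Applying T to f k recovers g k because the angle is not a multiple of a half turn.
\<close>

lemma cyclic_operator_T: "cyclic_operator scl T"
proof -
  let ?Y = "cyclic_subspace T seed"
  note sub = subspace_cyclic_subspace[of T seed]
  have f: "f k \<in> ?Y" for k
  proof -
    have "weight k *\<^sub>R f k = (\<Sum>j<Suc k. weight j *\<^sub>R f j) - (\<Sum>j<k. weight j *\<^sub>R f j)"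
      by simp
    also have "\<dots> \<in> ?Y"
      by (intro subspace_diff[OF sub] partial_seed_in_cyclic_subspace)
    finally have "(1 / weight k) *\<^sub>R (weight k *\<^sub>R f k) \<in> ?Y"
      by (rule scaleR_in_subspace[OF sub])
    then show ?thesis using weight_pos[of k] by simp
  qed
  have g: "g k \<in> ?Y" for k
  proof -
    have "sin (angle k) \<noteq> 0"
    proof -
      have "(1 :: real) \<le> 2 ^ m k" by simp
      then have "(1 :: real) < 2 * 2 ^ m k" by linarith
      then have "angle k < pi"
        unfolding angle_def using pi_gt_zero by (simp add: divide_less_eq)
      then show ?thesis using sin_gt_zero[OF angle_pos, of k] by simp
    qed
    have "sin (angle k) *\<^sub>R g k = T (f k) - cos (angle k) *\<^sub>R f k"
      using T_planar[of k 1] by (simp add: planar_def)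
    also have "\<dots> \<in> ?Y"
      by (rule subspace_diff[OF sub cyclic_subspace_invariant[OF bounded_linear_T T_scl f]
            scaleR_in_subspace[OF sub f]])
    finally have "(1 / sin (angle k)) *\<^sub>R (sin (angle k) *\<^sub>R g k) \<in> ?Y"
      by (rule scaleR_in_subspace[OF sub])
    then show ?thesis using \<open>sin (angle k) \<noteq> 0\<close> by simp
  qed
  have "span (range f \<union> range g) \<subseteq> ?Y"
    using f g by (intro span_minimal[OF _ sub]) auto
  then have "closure (span (range f \<union> range g)) \<subseteq> ?Y"
    by (rule closure_minimal[OF _ closed_cyclic_subspace])
  then have "?Y = UNIV" using dense_span by (simp add: top.extremum_unique)
  then have "cyclic_vector scl T seed" by (rule cyclic_vector_of_cyclic_subspace)
  then show ?thesis unfolding cyclic_operator_def by (rule exI)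
qed

end

section \<open>Rotation operators on separable spaces\<close>

context scalar_banach_space begin

text \<open>
  The even members of the biorthogonal sequence are rescaled to become f k, with functionals as
  small as required, the odd ones are normalised to become g k. Only then are the exponents m k chosen,
  large enough for the angles to compensate for the norms of these vectors and functionals.
\<close>

lemma rotation_blocks_exist:
  fixes e :: "nat \<Rightarrow> 'a" and \<phi> :: "nat \<Rightarrow> 'a \<Rightarrow> 'k"
  assumes \<phi>: "\<And>n. functional (\<phi> n)"
    and biorth: "\<And>i j. \<phi> i (e j) = (if i = j then 1 else 0)"
    and dense: "closure (span (range e)) = UNIV"
  obtains f g fs gs m where "rotation_blocks scl f g fs gs m"
proof -
  have "\<exists>C>0. \<forall>x. norm (\<phi> n x) \<le> norm x * C" for n
    using \<phi>[of n] bounded_linear.pos_bounded by (auto simp: functional_def)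
  then obtain C where C: "\<And>n. C n > 0" "\<And>n x. norm (\<phi> n x) \<le> norm x * C n" by metis
  have e_nz: "e n \<noteq> 0" for n
    using biorth[of n n] functional_sub[OF \<phi>, of n 0 0] by auto
  define s where "s k = C (2 * k) * 4 ^ k" for k
  define r where "r k = norm (e (2 * k + 1))" for k
  have s: "s k > 0" and r: "r k > 0" for k
    using C(1) e_nz by (simp_all add: s_def r_def)
  define f where "f k = scl (of_real (s k)) (e (2 * k))" for k
  define g where "g k = scl (of_real (1 / r k)) (e (2 * k + 1))" for k
  define fs where "fs k x = of_real (1 / s k) * \<phi> (2 * k) x" for k x
  define gs where "gs k x = of_real (r k) * \<phi> (2 * k + 1) x" for k x
  have fs_le: "norm (fs k x) \<le> (1 / 4) ^ k * norm x" for k x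
  proof -
    have "norm (fs k x) = norm (\<phi> (2 * k) x) / s k"
      using s[of k] by (simp add: fs_def norm_mult norm_divide)
    also have "\<dots> \<le> norm x * C (2 * k) / s k"
      using C(2)[of "2 * k" x] s[of k] by (intro divide_right_mono) auto
    also have "\<dots> = (1 / 4) ^ k * norm x"
      using C(1)[of "2 * k"] by (simp add: s_def power_one_over field_simps)
    finally show ?thesis .
  qed
  have gs_le: "norm (gs k x) \<le> r k * C (2 * k + 1) * norm x" for k x
  proof -
    have "norm (gs k x) = r k * norm (\<phi> (2 * k + 1) x)"
      using r[of k] by (simp add: gs_def norm_mult)
    also have "\<dots> \<le> r k * (norm x * C (2 * k + 1))"
      using C(2)[of "2 * k + 1" x] r[of k] by (intro mult_left_mono) auto
    finally show ?thesis by (simp add: mult_ac)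
  qed
  define B where "B k = ((1 / 4) ^ k + r k * C (2 * k + 1)) * (norm (f k) + norm (g k))" for k
  have "\<exists>n. 2 ^ k * (2 * B k) < (2 :: real) ^ n" for k
    by (rule real_arch_pow) simp
  then obtain h where h: "\<And>k. 2 ^ k * (2 * B k) < (2 :: real) ^ h k" by metis
  \<comment> \<open>summation makes the exponents strictly increasing while keeping each above h k\<close>
  define m where "m k = (\<Sum>j\<le>k. Suc (h j))" for k
  have m: "strict_mono m" unfolding strict_mono_Suc_iff by (simp add: m_def)
  have small: "pi / 2 ^ (m k + 1) * B k \<le> (1 / 2) ^ k" for k
  proof -
    have B: "B k \<ge> 0"
      unfolding B_def using r[of k] C(1)[of "2 * k + 1"]
      by (intro mult_nonneg_nonneg add_nonneg_nonneg) auto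
    have "h k \<le> m k"
      by (cases k) (simp_all add: m_def)
    then have "(2 :: real) ^ h k \<le> 2 ^ m k" by (intro power_increasing) auto
    then have "2 ^ k * (2 * B k) \<le> 2 ^ m k" using h[of k] by linarith
    moreover have "pi * B k \<le> 4 * B k" using B pi_less_4 by (intro mult_right_mono) auto
    then have "2 ^ k * (pi * B k) \<le> 2 ^ k * (4 * B k)" by (intro mult_left_mono) auto
    ultimately have "2 ^ k * (pi * B k) \<le> 2 * 2 ^ m k" by linarith
    then show ?thesis by (simp add: power_one_over field_simps)
  qed
  have e_in: "e n \<in> span (range f \<union> range g)" for n
  proof (cases "even n")
    case True
    then obtain k where "n = 2 * k" by (rule evenE)
    then have "e n = scl (of_real (1 / s k)) (f k)"
      using s[of k] by (simp add: f_def flip: of_real_mult)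
    then show ?thesis by (simp only:) (intro span_scale span_base, simp)
  next
    case False
    then obtain k where "n = 2 * k + 1" by (rule oddE)
    then have "e n = scl (of_real (r k)) (g k)"
      using r[of k] by (simp add: g_def flip: of_real_mult)
    then show ?thesis by (simp only:) (intro span_scale span_base, simp)
  qed
  have "rotation_blocks scl f g fs gs m"
  proof (unfold_locales)
    show "functional (fs k)" "functional (gs k)" for k
      unfolding fs_def gs_def by (intro functional_mult \<phi>)+
    have [simp]: "2 * i \<noteq> Suc (2 * j)" "Suc (2 * j) \<noteq> 2 * i" for i j :: nat by presburger+
    show "fs i (f j) = (if i = j then 1 else 0)" for i j
      using s[of i] s[of j] by (simp add: fs_def f_def functional_scale[OF \<phi>] biorth flip: of_real_mult)
    show "gs i (g j) = (if i = j then 1 else 0)" for i j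
      using r[of i] r[of j] by (simp add: gs_def g_def functional_scale[OF \<phi>] biorth flip: of_real_mult)
    show "fs i (g j) = 0" "gs i (f j) = 0" for i j
      by (simp_all add: fs_def gs_def f_def g_def functional_scale[OF \<phi>] biorth)
    have "span (range e) \<subseteq> span (range f \<union> range g)"
      using e_in by (intro span_minimal subspace_span) auto
    then show "closure (span (range f \<union> range g)) = UNIV"
      using closure_mono dense by blast
    show "strict_mono m" by (rule m)
    show "norm (fs k x) \<le> (1 / 4) ^ k * norm x" for k x by (rule fs_le)
    show "norm (g k) \<le> 1" for k
      using r[of k] by (simp add: g_def norm_scale norm_divide) (simp add: r_def)
    show "pi / 2 ^ (m k + 1) * (norm (fs k x) + norm (gs k x)) * (norm (f k) + norm (g k))
        \<le> (1 / 2) ^ k * norm x" for k x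
    proof -
      have "norm (fs k x) + norm (gs k x) \<le> ((1 / 4) ^ k + r k * C (2 * k + 1)) * norm x"
        using fs_le[of k x] gs_le[of k x] by (simp add: distrib_right)
      then have "pi / 2 ^ (m k + 1) * (norm (fs k x) + norm (gs k x)) * (norm (f k) + norm (g k))
          \<le> pi / 2 ^ (m k + 1) * (((1 / 4) ^ k + r k * C (2 * k + 1)) * norm x) * (norm (f k) + norm (g k))"
        by (intro mult_right_mono mult_left_mono) auto
      also have "\<dots> = (pi / 2 ^ (m k + 1) * B k) * norm x" by (simp add: B_def mult_ac)
      also have "\<dots> \<le> (1 / 2) ^ k * norm x" by (intro mult_right_mono small) simp
      finally show ?thesis .
    qed
  qed
  then show thesis by (rule that)
qed

lemma recurrent_cyclic_operator_exists:
  assumes "\<And>e. e \<noteq> 0 \<Longrightarrow> \<exists>\<phi>. functional \<phi> \<and> \<phi> e \<noteq> 0"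
    and "separable_space (euclidean :: 'a topology)"
    and "infinite_dimensional scl"
  shows "\<exists>T. is_operator scl T \<and> reiteratively_recurrent T \<and> cyclic_operator scl T \<and> meager (RRec T)"
proof -
  obtain \<phi> :: "nat \<Rightarrow> 'a \<Rightarrow> 'k" and e :: "nat \<Rightarrow> 'a"
    where e: "\<And>n. functional (\<phi> n)" "\<And>i j. \<phi> i (e j) = (if i = j then 1 else 0)"
      "closure (span (range e)) = UNIV"
    by (rule fundamental_biorthogonal_sequence[OF _ assms(2,3)]) (erule assms(1), rule that)
  obtain f g fs gs m where "rotation_blocks scl f g fs gs m"
    using rotation_blocks_exist[OF e] .
  then interpret rotation_blocks scl f g fs gs m .
  show ?thesis
    using is_operator_T reiteratively_recurrent_T cyclic_operator_T meager_RRec_T by blast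
qed

end

lemma scalar_banach_space_real: "scalar_banach_space (scaleR :: real \<Rightarrow> 'a::banach \<Rightarrow> 'a)"
  by unfold_locales simp_all

lemma real_functionals_separate:
  fixes e :: "'a::banach"
  assumes "e \<noteq> 0"
  shows "\<exists>\<phi>. scalar_banach_space.functional (scaleR :: real \<Rightarrow> 'a \<Rightarrow> 'a) \<phi> \<and> \<phi> e \<noteq> 0"
proof -
  interpret scalar_banach_space "scaleR :: real \<Rightarrow> 'a \<Rightarrow> 'a" by (rule scalar_banach_space_real)
  obtain f :: "'a \<Rightarrow> real" where f: "bounded_linear f" "f e \<noteq> 0"
    by (rule bounded_functional_nonzero[OF assms])
  then have "functional f"
    by (simp add: functional_def linear_scale[OF bounded_linear.linear])
  then show ?thesis using f(2) by blast
qed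

lemma scalar_banach_space_complex:
  "complex_banach_space scl \<Longrightarrow> scalar_banach_space scl"
  unfolding complex_banach_space_def complex_banach_space_axioms_def
    scalar_banach_space_def scalar_banach_space_axioms_def by simp

text \<open>
  The real part of a complex functional determines it: \<phi> x = f x - i f(i x).
\<close>

lemma complex_functionals_separate:
  assumes "complex_banach_space scl" and "e \<noteq> 0"
  shows "\<exists>\<phi>. scalar_banach_space.functional scl \<phi> \<and> \<phi> e \<noteq> 0"
proof -
  interpret scalar_banach_space scl by (rule scalar_banach_space_complex[OF assms(1)])
  obtain f :: "'a \<Rightarrow> real" where f: "bounded_linear f" "f e \<noteq> 0"
    by (rule bounded_functional_nonzero[OF assms(2)])
  note lin = bounded_linear.linear[OF f(1)]
  define \<phi> where "\<phi> x = complex_of_real (f x) - \<i> * complex_of_real (f (scl \<i> x))" for x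
  have "bounded_linear \<phi>"
    unfolding \<phi>_def
    by (intro bounded_linear_sub bounded_linear_const_mult
        bounded_linear_compose[OF bounded_linear_of_real] f(1)
        bounded_linear_compose[OF f(1) bounded_linear_scale])
  moreover have "\<phi> (scl c x) = c * \<phi> x" for c x
  proof -
    have c: "c = complex_of_real (Re c) + complex_of_real (Im c) * \<i>"
      by (simp add: complex_eq_iff)
    have split: "f (scl c y) = Re c * f y + Im c * f (scl \<i> y)" for y
    proof -
      have "scl c y = Re c *\<^sub>R y + Im c *\<^sub>R scl \<i> y"
        by (subst c) (simp only: scale_left_distrib scale_scale[symmetric] scale_of_real)
      then show ?thesis by (simp add: linear_add[OF lin] linear_scale[OF lin])
    qed
    have "scl \<i> (scl \<i> x) = - x"
      by (simp add: scale_minus_left)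
    then have "f (scl \<i> (scl \<i> x)) = - f x" by (simp only: linear_neg[OF lin])
    moreover have "scl \<i> (scl c x) = scl c (scl \<i> x)" by (rule scale_left_commute)
    ultimately show ?thesis
      by (simp only: \<phi>_def split) (simp add: complex_eq_iff algebra_simps)
  qed
  ultimately have "functional \<phi>" by (simp add: functional_def)
  moreover have "\<phi> e \<noteq> 0" using f(2) by (simp add: \<phi>_def complex_eq_iff)
  ultimately show ?thesis by blast
qed

theorem theorem3p1:
  shows
    "(separable_space (euclidean :: 'a::banach topology) \<and>
        infinite_dimensional (scaleR :: real \<Rightarrow> 'a \<Rightarrow> 'a) \<longrightarrow>
        (\<exists>T :: 'a \<Rightarrow> 'a.
           is_operator (scaleR :: real \<Rightarrow> 'a \<Rightarrow> 'a) T \<and> reiteratively_recurrent T \<and>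
           cyclic_operator (scaleR :: real \<Rightarrow> 'a \<Rightarrow> 'a) T \<and> meager (RRec T)))
     \<and>
     (\<forall>scl :: complex \<Rightarrow> 'b::banach \<Rightarrow> 'b.
        complex_banach_space scl \<and>
        separable_space (euclidean :: 'b topology) \<and> infinite_dimensional scl \<longrightarrow>
        (\<exists>T :: 'b \<Rightarrow> 'b.
           is_operator scl T \<and> reiteratively_recurrent T \<and>
           cyclic_operator scl T \<and> meager (RRec T)))"
proof (intro conjI impI allI; elim conjE)
  assume "separable_space (euclidean :: 'a topology)"
    "infinite_dimensional (scaleR :: real \<Rightarrow> 'a \<Rightarrow> 'a)"
  then show "\<exists>T :: 'a \<Rightarrow> 'a.
      is_operator (scaleR :: real \<Rightarrow> 'a \<Rightarrow> 'a) T \<and> reiteratively_recurrent T \<and>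
      cyclic_operator (scaleR :: real \<Rightarrow> 'a \<Rightarrow> 'a) T \<and> meager (RRec T)"
    using scalar_banach_space.recurrent_cyclic_operator_exists
        [OF scalar_banach_space_real real_functionals_separate, where 'a = 'a] by simp
next
  fix scl :: "complex \<Rightarrow> 'b \<Rightarrow> 'b"
  assume c: "complex_banach_space scl"
    and "separable_space (euclidean :: 'b topology)" "infinite_dimensional scl"
  then show "\<exists>T :: 'b \<Rightarrow> 'b.
      is_operator scl T \<and> reiteratively_recurrent T \<and>
      cyclic_operator scl T \<and> meager (RRec T)"
    using scalar_banach_space.recurrent_cyclic_operator_exists
        [OF scalar_banach_space_complex[OF c] complex_functionals_separate[OF c]] by simp
qed

end
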